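(* Let $(\mathfrak s=\mathfrak a\oplus\mathfrak n,\langle\cdot,\cdot\rangle)$ be a solvable pseudo-Riemannian metric Lie algebra of strong Iwasawa type, and let $(\mathfrak s'=\mathfrak a'\oplus\mathfrak n',\langle\cdot,\cdot\rangle')$ be the attached metric subalgebra defined by a subset $\Lambda'$ of $\mathfrak a^*$ (a proper subset $\Lambda'\subsetneq\Lambda$ satisfying the conditions in the context). Let $H$ and $H'$ denote the mean curvature vectors of $(\mathfrak s,\langle\cdot,\cdot\rangle)$ and $(\mathfrak s',\langle\cdot,\cdot\rangle')$ respectively, and let $\mathrm{Ric}^{\mathfrak s},\mathrm{Ric}^{\mathfrak s'},\mathrm{Ric}^{\mathfrak n},\mathrm{Ric}^{\mathfrak n'}$ denote the Ricci endomorphisms of the corresponding metric Lie algebras (each with the restricted scalar product). Then the following are equivalent: (i) $\mathrm{Ric}^{\mathfrak s}(X)=\mathrm{Ric}^{\mathfrak s'}(X)$ for every $X\in\mathfrak s'$. (ii) $\mathrm{Ric}^{\mathfrak n}(X)-\mathrm{Ric}^{\mathfrak n'}(X)=[H-H',X]$ for every $X\in\mathfrak n'$. (iii) The Jacobi Star Condition holds for $(\mathfrak s',\langle\cdot,\cdot\rangle')$.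
   Context: All Lie algebras are real and finite-dimensional. A (pseudo-Riemannian) metric Lie algebra is a Lie algebra with a nondegenerate symmetric bilinear form (scalar product) $\langle\cdot,\cdot\rangle$. An orthonormal basis $\{E_i\}$ consists of pairwise orthogonal vectors with $\epsilon_i:=\langle E_i,E_i\rangle\in\{-1,1\}$. Strong Iwasawa type: a solvable metric Lie algebra $(\mathfrak s,\langle\cdot,\cdot\rangle)$ such that (1) $\mathfrak s=\mathfrak a\oplus\mathfrak n$ where $\mathfrak n=[\mathfrak s,\mathfrak s]$ and $\mathfrak a$ is the orthogonal complement of $\mathfrak n$ and is abelian; (2) for every $A\in\mathfrak a$, $\mathrm{ad}_A$ is symmetric with respect to $\langle\cdot,\cdot\rangle$, and $\mathrm{ad}_A=0$ iff $A=0$; (3) there is $A^0\in\mathfrak a$ such that $\mathrm{ad}_{A^0}|_{\mathfrak n}$ has all eigenvalues positive; (4) $\langle\cdot,\cdot\rangle$ is positive definite on $\mathfrak a$. Roots: for $\alpha\in\mathfrak a^*$, $\mathfrak n_\alpha=\{X\in\mathfrak n: [A,X]=\alpha(A)X\ \forall A\in\mathfrak a\}$; $\alpha$ is a root if $\mathfrak n_\alpha\ne0$, and $\Delta$ is the set of roots. It is assumed that $\mathfrak n=\bigoplus_{\alpha\in\Delta}\mathfrak n_\alpha$ (an orthogonal direct sum, with $\langle\cdot,\cdot\rangle$ nondegenerate on each $\mathfrak n_\alpha$). $\mathfrak a^*$ carries the scalar product dual to that of $\mathfrak a$. For a root $\beta$, $\check s_\beta:\mathfrak a^*\to\mathfrak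 a^*$ is the reflection $\check s_\beta(\alpha)=\alpha-\frac{2\langle\alpha,\beta\rangle}{\langle\beta,\beta\rangle}\beta$. Attached subalgebra: let $\Lambda=\{\alpha_i\}\subseteq\Delta$ be a finite set that is a basis of $\mathfrak a^*$ and such that every root is a linear combination of elements of $\Lambda$ with coefficients in $\mathbb Z_{\ge0}$. Let $\{B_{\alpha_i}\}$ be the dual basis of $\mathfrak a$: $\alpha_i(B_{\alpha_j})=\delta_{ij}$. Let $\Lambda'\subsetneq\Lambda$ and $Z=\sum_{\alpha\in\Lambda\setminus\Lambda'}B_\alpha$. Assume that for every $\alpha_j\in\Lambda'$, $\check s_{\alpha_j}$ permutes the set of roots $\alpha$ with $\alpha(Z)>0$, and $\dim\mathfrak n_\alpha=\dim\mathfrak n_{\check s_{\alpha_j}(\alpha)}$ for each such $\alpha$. The attached subalgebra defined by $\Lambda'$ is $\mathfrak s'=\mathfrak a'\oplus\mathfrak n'$ with $\mathfrak a'=\mathrm{span}\{B_\alpha:\alpha\in\Lambda\setminus\Lambda'\}$, $\mathfrak n'=\bigoplus_{\alpha\in\Delta,\,\alpha(Z)>0}\mathfrak n_\alpha$, with the restricted scalar product $\langle\cdot,\cdot\rangle'$. Also $\mathfrak n_0=\bigoplus_{\alpha\in\Delta,\,\alpha(Z)=0}\mathfrak n_\alpha$, so $\mathfrak n=\mathfrak n'\oplus\mathfrak n_0$. A compatible orthonormal basis is an orthonormal basis $\{E_j'\}\cup\{E_j^\perp\}$ of $\mathfrak n$, each vector lying in a root space, with $\{E_j'\}$ a basis of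 $\mathfrak n'$ and $\{E_j^\perp\}$ a basis of $\mathfrak n_0$. Adjoints: for a subalgebra $\mathfrak h$ and $X\in\mathfrak h$, $(\mathrm{ad}_X)^{*,\mathfrak h}:\mathfrak h\to\mathfrak h$ is the adjoint of $\mathrm{ad}_X|_{\mathfrak h}$ with respect to the restricted scalar product on $\mathfrak h$. Mean curvature vector of a metric Lie algebra $\mathfrak s$ of strong Iwasawa type: the unique $H\in\mathfrak s$ with $\langle H,X\rangle=\mathrm{tr}\,\mathrm{ad}_X$ for all $X\in\mathfrak s$ (similarly $H'\in\mathfrak s'$ for $\mathfrak s'$). Ricci endomorphism of a metric Lie algebra $\mathfrak g$: $\langle\mathrm{Ric}^{\mathfrak g}X,Y\rangle=\mathrm{ric}^{\mathfrak g}(X,Y)$, where $\mathrm{ric}^{\mathfrak g}$ is the Ricci tensor (at the identity) of the corresponding left-invariant pseudo-Riemannian metric, $\mathrm{ric}(Y,W)=\mathrm{tr}(X\mapsto R(X,Y)W)$, $R(X,Y)=[\nabla_X,\nabla_Y]-\nabla_{[X,Y]}$, $\nabla$ the Levi-Civita connection. Jacobi Star Condition for $(\mathfrak s',\langle\cdot,\cdot\rangle')$: there is a compatible orthonormal basis $\{E_j'\}\cup\{E_j^\perp\}$ of $\mathfrak n=\mathfrak n'\oplus\mathfrak n_0$ such that, with $\epsilon_j=\langle E_j^\perp,E_j^\perp\rangle$, $$\tfrac12\sum_j\epsilon_j\big[(\mathrm{ad}_{E_j^\perp})^{*,\mathfrak n},\mathrm{ad}_{E_j^\perp}\big](X)=\mathrm{ad}_{\sum_j\epsilon_j(\mathrm{ad}_{E_j^\perp})^{*,\mathfrak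 s}E_j^\perp}(X)\quad\text{for all }X\in\mathfrak n',$$ where the bracket on the left is the commutator of endomorphisms of $\mathfrak n$. *)

theory Defs
  imports "HOL-Analysis.Analysis"
begin

text \<open>
  A real metric Lie algebra \<open>\<s>\<close> is given by a real vector space \<open>'v\<close>, a bracket
  \<open>br :: 'v \<Rightarrow> 'v \<Rightarrow> 'v\<close> and a scalar product \<open>g :: 'v \<Rightarrow> 'v \<Rightarrow> real\<close>. Subalgebras \<open>h\<close> are
  subsets of \<open>'v\<close>, and the notions which also have to be used for subalgebras (traces, adjoints,
  mean curvature vector, Ricci endomorphism) are relative to such a set \<open>h\<close>.
\<close>

definition metric_lie_algebra ::
  "('v::real_vector \<Rightarrow> 'v \<Rightarrow> 'v) \<Rightarrow> ('v \<Rightarrow> 'v \<Rightarrow> real) \<Rightarrow> bool" where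
  "metric_lie_algebra br g \<longleftrightarrow>
     (\<exists>S::'v set. finite S \<and> span S = UNIV) \<and>
     bilinear br \<and>
     (\<forall>x. br x x = 0) \<and>
     (\<forall>x y z. br x (br y z) + br y (br z x) + br z (br x y) = 0) \<and>
     bilinear g \<and>
     (\<forall>x y. g x y = g y x) \<and>
     (\<forall>x. (\<forall>y. g x y = 0) \<longrightarrow> x = 0)"

definition bracket_space :: "('v::real_vector \<Rightarrow> 'v \<Rightarrow> 'v) \<Rightarrow> 'v set \<Rightarrow> 'v set" where
  "bracket_space br h = span {br x y | x y. x \<in> h \<and> y \<in> h}"

definition solvable_lie :: "('v::real_vector \<Rightarrow> 'v \<Rightarrow> 'v) \<Rightarrow> bool" where
  "solvable_lie br \<longleftrightarrow> (\<exists>k. (bracket_space br ^^ k) UNIV = {0})"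

text \<open>Traces, adjoints and eigenvalues of endomorphisms of a subspace \<open>h\<close>.\<close>

definition trace_on :: "'v::real_vector set \<Rightarrow> ('v \<Rightarrow> 'v) \<Rightarrow> real" where
  "trace_on h f =
     (let B = (SOME B. independent B \<and> span B = h) in \<Sum>b\<in>B. representation B (f b) b)"

definition adjoint_on ::
  "'v::real_vector set \<Rightarrow> ('v \<Rightarrow> 'v \<Rightarrow> real) \<Rightarrow> ('v \<Rightarrow> 'v) \<Rightarrow> 'v \<Rightarrow> 'v" where
  "adjoint_on h g f x = (THE v. v \<in> h \<and> (\<forall>y\<in>h. g v y = g x (f y)))"

text \<open>
  Since \<open>g\<close> may be indefinite on \<open>\<n>\<close>, a symmetric operator can have non-real eigenvalues, so
  eigenvalues are those of the complexification: \<open>c\<close> is an eigenvalue of \<open>f\<close> on \<open>h\<close> if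
  \<open>f x + i f y = c (x + i y)\<close> for some \<open>x + i y \<noteq> 0\<close> with \<open>x, y \<in> h\<close>.
\<close>

definition eigenvalue_on :: "'v::real_vector set \<Rightarrow> ('v \<Rightarrow> 'v) \<Rightarrow> complex \<Rightarrow> bool" where
  "eigenvalue_on h f c \<longleftrightarrow>
     (\<exists>x\<in>h. \<exists>y\<in>h. (x \<noteq> 0 \<or> y \<noteq> 0) \<and>
        f x = Re c *\<^sub>R x - Im c *\<^sub>R y \<and> f y = Im c *\<^sub>R x + Re c *\<^sub>R y)"

text \<open>Strong Iwasawa type. The decomposition \<open>\<s> = \<a> \<oplus> \<n>\<close> is determined by \<open>br\<close> and \<open>g\<close>.\<close>

definition nn :: "('v::real_vector \<Rightarrow> 'v \<Rightarrow> 'v) \<Rightarrow> 'v set" where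
  "nn br = bracket_space br UNIV"

definition aa :: "('v::real_vector \<Rightarrow> 'v \<Rightarrow> 'v) \<Rightarrow> ('v \<Rightarrow> 'v \<Rightarrow> real) \<Rightarrow> 'v set" where
  "aa br g = {A. \<forall>X\<in>nn br. g A X = 0}"

definition strong_iwasawa ::
  "('v::real_vector \<Rightarrow> 'v \<Rightarrow> 'v) \<Rightarrow> ('v \<Rightarrow> 'v \<Rightarrow> real) \<Rightarrow> bool" where
  "strong_iwasawa br g \<longleftrightarrow>
     metric_lie_algebra br g \<and> solvable_lie br \<and>
     {A + X | A X. A \<in> aa br g \<and> X \<in> nn br} = UNIV \<and> aa br g \<inter> nn br = {0} \<and>
     (\<forall>A\<in>aa br g. \<forall>B\<in>aa br g. br A B = 0) \<and>
     (\<forall>A\<in>aa br g. (\<forall>x y. g (br A x) y = g x (br A y)) \<and> ((\<forall>x. br A x = 0) \<longleftrightarrow> A = 0)) \<and>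
     (\<exists>A\<in>aa br g. \<forall>c. eigenvalue_on (nn br) (br A) c \<longrightarrow> Im c = 0 \<and> Re c > 0) \<and>
     (\<forall>A\<in>aa br g. A \<noteq> 0 \<longrightarrow> g A A > 0)"

text \<open>
  Roots. The dual space \<open>\<a>\<^sup>*\<close> is identified, via \<open>\<s> = \<a> \<oplus> \<n>\<close>, with the space of
  linear functionals on \<open>\<s>\<close> that vanish on \<open>\<n>\<close>.
\<close>

definition adual :: "('v::real_vector \<Rightarrow> 'v \<Rightarrow> 'v) \<Rightarrow> ('v \<Rightarrow> real) set" where
  "adual br = {\<alpha>. linear \<alpha> \<and> (\<forall>X\<in>nn br. \<alpha> X = 0)}"

definition root_space ::
  "('v::real_vector \<Rightarrow> 'v \<Rightarrow> 'v) \<Rightarrow> ('v \<Rightarrow> 'v \<Rightarrow> real) \<Rightarrow> ('v \<Rightarrow> real) \<Rightarrow> 'v set" where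
  "root_space br g \<alpha> = {X \<in> nn br. \<forall>A\<in>aa br g. br A X = \<alpha> A *\<^sub>R X}"

definition roots ::
  "('v::real_vector \<Rightarrow> 'v \<Rightarrow> 'v) \<Rightarrow> ('v \<Rightarrow> 'v \<Rightarrow> real) \<Rightarrow> ('v \<Rightarrow> real) set" where
  "roots br g = {\<alpha> \<in> adual br. root_space br g \<alpha> \<noteq> {0}}"

definition root_decomposition ::
  "('v::real_vector \<Rightarrow> 'v \<Rightarrow> 'v) \<Rightarrow> ('v \<Rightarrow> 'v \<Rightarrow> real) \<Rightarrow> bool" where
  "root_decomposition br g \<longleftrightarrow>
     nn br = span (\<Union>\<alpha>\<in>roots br g. root_space br g \<alpha>) \<and>
     (\<forall>F X. finite F \<and> F \<subseteq> roots br g \<and> (\<forall>\<alpha>\<in>F. X \<alpha> \<in> root_space br g \<alpha>) \<and>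
        (\<Sum>\<alpha>\<in>F. X \<alpha>) = 0 \<longrightarrow> (\<forall>\<alpha>\<in>F. X \<alpha> = 0)) \<and>
     (\<forall>\<alpha>\<in>roots br g. \<forall>\<beta>\<in>roots br g. \<alpha> \<noteq> \<beta> \<longrightarrow>
        (\<forall>X\<in>root_space br g \<alpha>. \<forall>Y\<in>root_space br g \<beta>. g X Y = 0)) \<and>
     (\<forall>\<alpha>\<in>roots br g. \<forall>X\<in>root_space br g \<alpha>. (\<forall>Y\<in>root_space br g \<alpha>. g X Y = 0) \<longrightarrow> X = 0)"

text \<open>The scalar product on \<open>\<a>\<^sup>*\<close> dual to that of \<open>\<a>\<close>, and the reflections.\<close>

definition sharp ::
  "('v::real_vector \<Rightarrow> 'v \<Rightarrow> 'v) \<Rightarrow> ('v \<Rightarrow> 'v \<Rightarrow> real) \<Rightarrow> ('v \<Rightarrow> real) \<Rightarrow> 'v" where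
  "sharp br g \<alpha> = (THE C. C \<in> aa br g \<and> (\<forall>A\<in>aa br g. g C A = \<alpha> A))"

definition dual_prod ::
  "('v::real_vector \<Rightarrow> 'v \<Rightarrow> 'v) \<Rightarrow> ('v \<Rightarrow> 'v \<Rightarrow> real) \<Rightarrow> ('v \<Rightarrow> real) \<Rightarrow> ('v \<Rightarrow> real) \<Rightarrow> real" where
  "dual_prod br g \<alpha> \<beta> = g (sharp br g \<alpha>) (sharp br g \<beta>)"

definition reflection ::
  "('v::real_vector \<Rightarrow> 'v \<Rightarrow> 'v) \<Rightarrow> ('v \<Rightarrow> 'v \<Rightarrow> real) \<Rightarrow> ('v \<Rightarrow> real) \<Rightarrow> ('v \<Rightarrow> real) \<Rightarrow> 'v \<Rightarrow> real" where
  "reflection br g \<beta> \<alpha> = (\<lambda>x. \<alpha> x - 2 * dual_prod br g \<alpha> \<beta> / dual_prod br g \<beta> \<beta> * \<beta> x)"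

text \<open>
  Attached subalgebras. Function spaces carry no vector space structure here, so being a
  basis of \<open>\<a>\<^sup>*\<close> is spelled out as linear independence and spanning.
\<close>

definition adual_basis ::
  "('v::real_vector \<Rightarrow> 'v \<Rightarrow> 'v) \<Rightarrow> ('v \<Rightarrow> real) set \<Rightarrow> bool" where
  "adual_basis br L \<longleftrightarrow>
     finite L \<and> L \<subseteq> adual br \<and>
     (\<forall>c. (\<forall>x. (\<Sum>\<beta>\<in>L. c \<beta> * \<beta> x) = 0) \<longrightarrow> (\<forall>\<beta>\<in>L. c \<beta> = 0)) \<and>
     (\<forall>\<alpha>\<in>adual br. \<exists>c. \<forall>x. \<alpha> x = (\<Sum>\<beta>\<in>L. c \<beta> * \<beta> x))"

definition dual_vec ::
  "('v::real_vector \<Rightarrow> 'v \<Rightarrow> 'v) \<Rightarrow> ('v \<Rightarrow> 'v \<Rightarrow> real) \<Rightarrow> ('v \<Rightarrow> real) set \<Rightarrow> ('v \<Rightarrow> real) \<Rightarrow> 'v" where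
  "dual_vec br g L \<beta> = (THE C. C \<in> aa br g \<and> (\<forall>\<alpha>\<in>L. \<alpha> C = (if \<alpha> = \<beta> then 1 else 0)))"

definition zvec ::
  "('v::real_vector \<Rightarrow> 'v \<Rightarrow> 'v) \<Rightarrow> ('v \<Rightarrow> 'v \<Rightarrow> real) \<Rightarrow> ('v \<Rightarrow> real) set \<Rightarrow> ('v \<Rightarrow> real) set \<Rightarrow> 'v" where
  "zvec br g L L' = (\<Sum>\<alpha>\<in>L - L'. dual_vec br g L \<alpha>)"

definition pos_roots ::
  "('v::real_vector \<Rightarrow> 'v \<Rightarrow> 'v) \<Rightarrow> ('v \<Rightarrow> 'v \<Rightarrow> real) \<Rightarrow> ('v \<Rightarrow> real) set \<Rightarrow> ('v \<Rightarrow> real) set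
     \<Rightarrow> ('v \<Rightarrow> real) set" where
  "pos_roots br g L L' = {\<alpha> \<in> roots br g. \<alpha> (zvec br g L L') > 0}"

definition null_roots ::
  "('v::real_vector \<Rightarrow> 'v \<Rightarrow> 'v) \<Rightarrow> ('v \<Rightarrow> 'v \<Rightarrow> real) \<Rightarrow> ('v \<Rightarrow> real) set \<Rightarrow> ('v \<Rightarrow> real) set
     \<Rightarrow> ('v \<Rightarrow> real) set" where
  "null_roots br g L L' = {\<alpha> \<in> roots br g. \<alpha> (zvec br g L L') = 0}"

definition attaching_data ::
  "('v::real_vector \<Rightarrow> 'v \<Rightarrow> 'v) \<Rightarrow> ('v \<Rightarrow> 'v \<Rightarrow> real) \<Rightarrow> ('v \<Rightarrow> real) set \<Rightarrow> ('v \<Rightarrow> real) set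
     \<Rightarrow> bool" where
  "attaching_data br g L L' \<longleftrightarrow>
     L \<subseteq> roots br g \<and> adual_basis br L \<and>
     (\<forall>\<alpha>\<in>roots br g. \<exists>c :: ('v \<Rightarrow> real) \<Rightarrow> nat. \<forall>x. \<alpha> x = (\<Sum>\<beta>\<in>L. real (c \<beta>) * \<beta> x)) \<and>
     L' \<subset> L \<and>
     (\<forall>\<beta>\<in>L'.
        bij_betw (reflection br g \<beta>) (pos_roots br g L L') (pos_roots br g L L') \<and>
        (\<forall>\<alpha>\<in>pos_roots br g L L'.
           dim (root_space br g \<alpha>) = dim (root_space br g (reflection br g \<beta> \<alpha>))))"

definition att_a ::
  "('v::real_vector \<Rightarrow> 'v \<Rightarrow> 'v) \<Rightarrow> ('v \<Rightarrow> 'v \<Rightarrow> real) \<Rightarrow> ('v \<Rightarrow> real) set \<Rightarrow> ('v \<Rightarrow> real) set \<Rightarrow> 'v set" where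
  "att_a br g L L' = span (dual_vec br g L ` (L - L'))"

definition att_n ::
  "('v::real_vector \<Rightarrow> 'v \<Rightarrow> 'v) \<Rightarrow> ('v \<Rightarrow> 'v \<Rightarrow> real) \<Rightarrow> ('v \<Rightarrow> real) set \<Rightarrow> ('v \<Rightarrow> real) set \<Rightarrow> 'v set" where
  "att_n br g L L' = span (\<Union>\<alpha>\<in>pos_roots br g L L'. root_space br g \<alpha>)"

definition att_n0 ::
  "('v::real_vector \<Rightarrow> 'v \<Rightarrow> 'v) \<Rightarrow> ('v \<Rightarrow> 'v \<Rightarrow> real) \<Rightarrow> ('v \<Rightarrow> real) set \<Rightarrow> ('v \<Rightarrow> real) set \<Rightarrow> 'v set" where
  "att_n0 br g L L' = span (\<Union>\<alpha>\<in>null_roots br g L L'. root_space br g \<alpha>)"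

definition att_s ::
  "('v::real_vector \<Rightarrow> 'v \<Rightarrow> 'v) \<Rightarrow> ('v \<Rightarrow> 'v \<Rightarrow> real) \<Rightarrow> ('v \<Rightarrow> real) set \<Rightarrow> ('v \<Rightarrow> real) set \<Rightarrow> 'v set" where
  "att_s br g L L' = {A + X | A X. A \<in> att_a br g L L' \<and> X \<in> att_n br g L L'}"

definition mean_curvature ::
  "'v::real_vector set \<Rightarrow> ('v \<Rightarrow> 'v \<Rightarrow> 'v) \<Rightarrow> ('v \<Rightarrow> 'v \<Rightarrow> real) \<Rightarrow> 'v" where
  "mean_curvature h br g = (THE H. H \<in> h \<and> (\<forall>X\<in>h. g H X = trace_on h (br X)))"

text \<open>
  Levi-Civita connection of the left-invariant metric defined by a subalgebra \<open>h\<close>, on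
  left-invariant vector fields: since the functions \<open>g Y Z\<close> are then constant, metricity reads
  \<open>g (\<nabla>\<^sub>X Y) Z + g Y (\<nabla>\<^sub>X Z) = 0\<close>. The value \<open>0\<close> outside \<open>h\<close> only serves to make the
  operator unique as a function on \<open>'v\<close>.
\<close>

definition is_levi_civita ::
  "'v::real_vector set \<Rightarrow> ('v \<Rightarrow> 'v \<Rightarrow> 'v) \<Rightarrow> ('v \<Rightarrow> 'v \<Rightarrow> real) \<Rightarrow> ('v \<Rightarrow> 'v \<Rightarrow> 'v) \<Rightarrow> bool" where
  "is_levi_civita h br g D \<longleftrightarrow>
     (\<forall>X\<in>h. \<forall>Y\<in>h. D X Y \<in> h) \<and>
     (\<forall>X\<in>h. \<forall>Y\<in>h. \<forall>Z\<in>h. \<forall>r. D (r *\<^sub>R X + Y) Z = r *\<^sub>R D X Z + D Y Z) \<and>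
     (\<forall>X\<in>h. \<forall>Y\<in>h. \<forall>Z\<in>h. \<forall>r. D X (r *\<^sub>R Y + Z) = r *\<^sub>R D X Y + D X Z) \<and>
     (\<forall>X\<in>h. \<forall>Y\<in>h. D X Y - D Y X = br X Y) \<and>
     (\<forall>X\<in>h. \<forall>Y\<in>h. \<forall>Z\<in>h. g (D X Y) Z + g Y (D X Z) = 0) \<and>
     (\<forall>X Y. X \<notin> h \<or> Y \<notin> h \<longrightarrow> D X Y = 0)"

definition levi_civita ::
  "'v::real_vector set \<Rightarrow> ('v \<Rightarrow> 'v \<Rightarrow> 'v) \<Rightarrow> ('v \<Rightarrow> 'v \<Rightarrow> real) \<Rightarrow> 'v \<Rightarrow> 'v \<Rightarrow> 'v" where
  "levi_civita h br g = (THE D. is_levi_civita h br g D)"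

definition curvature ::
  "'v::real_vector set \<Rightarrow> ('v \<Rightarrow> 'v \<Rightarrow> 'v) \<Rightarrow> ('v \<Rightarrow> 'v \<Rightarrow> real) \<Rightarrow> 'v \<Rightarrow> 'v \<Rightarrow> 'v \<Rightarrow> 'v" where
  "curvature h br g X Y W =
     (let D = levi_civita h br g in D X (D Y W) - D Y (D X W) - D (br X Y) W)"

definition ric ::
  "'v::real_vector set \<Rightarrow> ('v \<Rightarrow> 'v \<Rightarrow> 'v) \<Rightarrow> ('v \<Rightarrow> 'v \<Rightarrow> real) \<Rightarrow> 'v \<Rightarrow> 'v \<Rightarrow> real" where
  "ric h br g Y W = trace_on h (\<lambda>X. curvature h br g X Y W)"

definition Ric ::
  "'v::real_vector set \<Rightarrow> ('v \<Rightarrow> 'v \<Rightarrow> 'v) \<Rightarrow> ('v \<Rightarrow> 'v \<Rightarrow> real) \<Rightarrow> 'v \<Rightarrow> 'v" where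
  "Ric h br g X = (THE V. V \<in> h \<and> (\<forall>Y\<in>h. g V Y = ric h br g X Y))"

text \<open>
  Compatible orthonormal bases, given as the sets \<open>E'\<close> and \<open>Ep\<close> of the vectors \<open>E\<^sub>j'\<close> and
  \<open>E\<^sub>j\<^sup>\<bottom>\<close> respectively.
\<close>

definition compatible_onb ::
  "('v::real_vector \<Rightarrow> 'v \<Rightarrow> 'v) \<Rightarrow> ('v \<Rightarrow> 'v \<Rightarrow> real) \<Rightarrow> ('v \<Rightarrow> real) set \<Rightarrow> ('v \<Rightarrow> real) set
     \<Rightarrow> 'v set \<Rightarrow> 'v set \<Rightarrow> bool" where
  "compatible_onb br g L L' E' Ep \<longleftrightarrow>
     independent (E' \<union> Ep) \<and> span (E' \<union> Ep) = nn br \<and>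
     (\<forall>e\<in>E' \<union> Ep. \<forall>f\<in>E' \<union> Ep. e \<noteq> f \<longrightarrow> g e f = 0) \<and>
     (\<forall>e\<in>E' \<union> Ep. g e e \<in> {-1, 1}) \<and>
     (\<forall>e\<in>E' \<union> Ep. \<exists>\<alpha>\<in>roots br g. e \<in> root_space br g \<alpha>) \<and>
     independent E' \<and> span E' = att_n br g L L' \<and>
     independent Ep \<and> span Ep = att_n0 br g L L'"

definition jacobi_star ::
  "('v::real_vector \<Rightarrow> 'v \<Rightarrow> 'v) \<Rightarrow> ('v \<Rightarrow> 'v \<Rightarrow> real) \<Rightarrow> ('v \<Rightarrow> real) set \<Rightarrow> ('v \<Rightarrow> real) set
     \<Rightarrow> bool" where
  "jacobi_star br g L L' \<longleftrightarrow>
     (\<exists>E' Ep. compatible_onb br g L L' E' Ep \<and>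
        (\<forall>X\<in>att_n br g L L'.
           (1/2) *\<^sub>R (\<Sum>e\<in>Ep. g e e *\<^sub>R
              (adjoint_on (nn br) g (br e) (br e X) - br e (adjoint_on (nn br) g (br e) X)))
           = br (\<Sum>e\<in>Ep. g e e *\<^sub>R adjoint_on UNIV g (br e) e) X))"

end

theory Submission
  imports Defs
begin

text \<open>
  For a metric Lie algebra \<open>h = a \<oplus> n\<close> of Iwasawa type the general Ricci formula collapses: some
  \<open>ad A0\<close> grades \<open>n\<close> by positive weights, so all traces involving \<open>ad X\<close> with \<open>X \<in> n\<close> vanish, and
  \<open>Ric h X = Ric n X - [H, X]\<close> on \<open>n\<close>, while on \<open>a\<close> the Ricci tensor is \<open>- tr (ad A ad B)\<close>.
  Applied to \<open>\<s>\<close> and \<open>\<s>'\<close>, this reduces (i) on \<open>\<n>'\<close> to (ii). On \<open>\<a>'\<close> condition (i) always holds: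
  the reflections in \<open>\<Lambda>'\<close> fix \<open>\<a>'\<close> and permute the roots of \<open>\<n>'\<close> with multiplicities, so the vectors
  \<open>\<Sum> dim n\<^sub>\<alpha> F(\<alpha>(A)) \<alpha>\<^sup>\<sharp>\<close> (sum over the roots of \<open>\<n>'\<close>, \<open>A \<in> \<a>'\<close>) are killed by
  \<open>\<Lambda>'\<close> and hence lie in \<open>\<a>'\<close>; for \<open>F = 1\<close> this gives \<open>H' \<in> \<a>'\<close> and for \<open>F = id\<close> minus \<open>Ric A\<close>.
  Finally \<open>Ric \<n> - Ric \<n>'\<close> is on \<open>\<n>'\<close> minus the left side of the Jacobi Star Condition for any
  compatible basis, and \<open>\<Sum> \<epsilon> ad_e\<^sup>* e = - \<Sum> \<alpha>_e\<^sup>\<sharp> = - (H - H')\<close>, which turns (ii) into (iii).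
\<close>

section \<open>Scalar products and orthonormal bases\<close>

locale scalar_product =
  fixes g :: "'v::real_vector \<Rightarrow> 'v \<Rightarrow> real"
  assumes bilinear_g: "bilinear g"
    and g_commute: "g x y = g y x"
begin

lemma linear_g_left: "linear (\<lambda>x. g x y)" and linear_g_right: "linear (g x)"
  using bilinear_g unfolding bilinear_def by auto

lemma g_add [simp]: "g (x + y) z = g x z + g y z" "g z (x + y) = g z x + g z y"
  using bilinear_g by (auto simp: bilinear_ladd bilinear_radd)

lemma g_diff [simp]: "g (x - y) z = g x z - g y z" "g z (x - y) = g z x - g z y"
  using bilinear_g by (auto simp: bilinear_lsub bilinear_rsub)

lemma g_minus [simp]: "g (- x) z = - g x z" "g z (- x) = - g z x"
  using bilinear_g by (auto simp: bilinear_lneg bilinear_rneg)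

lemma g_scale [simp]: "g (r *\<^sub>R x) z = r * g x z" "g z (r *\<^sub>R x) = r * g z x"
  using bilinear_g by (auto simp: bilinear_lmul bilinear_rmul)

lemma g_zero [simp]: "g 0 z = 0" "g z 0 = 0"
  using bilinear_g by (auto simp: bilinear_lzero bilinear_rzero)

lemma g_sum [simp]: "g (\<Sum>i\<in>I. u i) z = (\<Sum>i\<in>I. g (u i) z)" "g z (\<Sum>i\<in>I. u i) = (\<Sum>i\<in>I. g z (u i))"
  using linear_sum[OF linear_g_left] linear_sum[OF linear_g_right] by auto

lemma span_ortho:
  assumes "A \<in> span S" "X \<in> span T" "\<And>a e. a \<in> S \<Longrightarrow> e \<in> T \<Longrightarrow> g a e = 0"
  shows "g A X = 0"
proof -
  have "g a X = 0" if "a \<in> S" for a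
    using assms(2)
  proof (induction rule: span_induct_alt)
    case (step c e y) then show ?case using assms(3)[OF that] by simp
  qed simp
  note 1 = this
  show ?thesis using assms(1)
  proof (induction rule: span_induct_alt)
    case (step c a y) then show ?case using 1 by simp
  qed simp
qed

section \<open>Orthonormal bases in indefinite signature\<close>

definition orthonormal :: "'v set \<Rightarrow> bool" where
  "orthonormal B \<longleftrightarrow> (\<forall>e\<in>B. \<forall>f\<in>B. e \<noteq> f \<longrightarrow> g e f = 0) \<and> (\<forall>e\<in>B. g e e = 1 \<or> g e e = -1)"

text \<open>This one predicate carries the information that \<open>h\<close> is a finite-dimensional
  subspace on which \<open>g\<close> is nondegenerate; independence of \<open>B\<close> follows from
  the nonzero squares.\<close>

definition onb :: "'v set \<Rightarrow> 'v set \<Rightarrow> bool" where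
  "onb h B \<longleftrightarrow> finite B \<and> span B = h \<and> orthonormal B"

lemma orthonormal_square: "orthonormal B \<Longrightarrow> e \<in> B \<Longrightarrow> g e e * g e e = 1"
  unfolding orthonormal_def by force

lemma orthonormal_coeff:
  assumes "orthonormal B" "finite B" "e \<in> B"
  shows "g (\<Sum>f\<in>B. c f *\<^sub>R f) e = c e * g e e"
proof -
  have "g (\<Sum>f\<in>B. c f *\<^sub>R f) e = (\<Sum>f\<in>B. if f = e then c e * g e e else 0)"
    using assms unfolding g_sum by (intro sum.cong) (auto simp: orthonormal_def)
  then show ?thesis using assms by simp
qed

lemma orthonormal_independent:
  assumes "orthonormal B"
  shows "independent B"
proof -
  have "\<forall>v\<in>t. u v = 0" if "finite t" "t \<subseteq> B" "(\<Sum>v\<in>t. u v *\<^sub>R v) = 0" for t u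
  proof
    fix v assume v: "v \<in> t"
    have "orthonormal t" using assms that unfolding orthonormal_def by blast
    then have "u v * g v v = 0" "g v v * g v v = 1"
      using orthonormal_coeff[of t v u] orthonormal_square[of t v] that v by auto
    then show "u v = 0" by auto
  qed
  then show ?thesis unfolding independent_explicit_module by blast
qed

lemma onb_in: "onb h B \<Longrightarrow> e \<in> B \<Longrightarrow> e \<in> h"
  unfolding onb_def using span_base by blast

lemma onb_subspace: "onb h B \<Longrightarrow> subspace h"
  unfolding onb_def using subspace_span by blast

text \<open>The coefficient of \<open>e\<close> in \<open>x\<close> is \<open>g x e / g e e\<close>;
  since \<open>g e e\<close> is a sign, dividing by it is multiplying by it.\<close>

lemma onb_expand:
  assumes "onb h B" "x \<in> h"
  shows "x = (\<Sum>e\<in>B. (g e e * g x e) *\<^sub>R e)"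
proof -
  have B: "finite B" "span B = h" "orthonormal B" using assms unfolding onb_def by auto
  obtain c where c: "x = (\<Sum>e\<in>B. c e *\<^sub>R e)"
    using assms(2) B span_finite[of B] by auto
  have "g e e * g x e = c e" if "e \<in> B" for e
    unfolding c using orthonormal_coeff[OF B(3,1) that] orthonormal_square[OF B(3) that]
    by (simp add: mult.left_commute)
  then show ?thesis using c by (metis (no_types, lifting) sum.cong)
qed

lemma onb_expand_g:
  assumes "onb h B" "x \<in> h"
  shows "(\<Sum>e\<in>B. g e e * g x e * g e y) = g x y"
  using arg_cong[OF onb_expand[OF assms], of "\<lambda>x. g x y"] by simp

lemma onb_sum_in: "onb h B \<Longrightarrow> (\<Sum>e\<in>B. c e *\<^sub>R e) \<in> h"
  unfolding onb_def by (auto intro: span_sum span_mul span_base)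

lemma onb_eqI:
  assumes "onb h B" "x \<in> h" "y \<in> h" "\<And>e. e \<in> B \<Longrightarrow> g x e = g y e"
  shows "x = y"
  using onb_expand[OF assms(1,2)] onb_expand[OF assms(1,3)] assms(4) by (simp cong: sum.cong)

text \<open>\<open>adjoint_on\<close>, \<open>sharp\<close>, \<open>mean_curvature\<close> and
  \<open>Ric\<close> are all descriptions of this shape, so each is evaluated by exhibiting a vector
  of \<open>h\<close> with the right products.\<close>

lemma onb_the_eq:
  assumes "onb h B" "v \<in> h" "\<And>y. y \<in> h \<Longrightarrow> g v y = F y"
  shows "(THE v. v \<in> h \<and> (\<forall>y\<in>h. g v y = F y)) = v"
proof (rule the_equality)
  show "w = v" if "w \<in> h \<and> (\<forall>y\<in>h. g w y = F y)" for w
    using onb_eqI[OF assms(1), of w v] that assms onb_in by metis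
qed (use assms in auto)

lemma onb_represent:
  assumes "onb h B" "linear F" "y \<in> h"
  shows "g (\<Sum>e\<in>B. (g e e * F e) *\<^sub>R e) y = F y"
proof -
  have "F y = F (\<Sum>e\<in>B. (g e e * g y e) *\<^sub>R e)" using onb_expand[OF assms(1,3)] by simp
  also have "\<dots> = (\<Sum>e\<in>B. g e e * g y e * F e)"
    by (simp add: linear_sum[OF assms(2)] linear_scale[OF assms(2)])
  finally show ?thesis by (simp add: g_commute mult_ac)
qed

lemma onb_riesz:
  assumes "onb h B" "linear F"
  shows "\<exists>v\<in>h. \<forall>y\<in>h. g v y = F y"
  using onb_sum_in[OF assms(1), of "\<lambda>e. g e e * F e"] onb_represent[OF assms] by (intro bexI) auto

lemma adjoint_on:
  assumes "onb h B" "linear f"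
  shows "adjoint_on h g f x \<in> h" "y \<in> h \<Longrightarrow> g (adjoint_on h g f x) y = g x (f y)"
proof -
  obtain v where v: "v \<in> h" "\<And>y. y \<in> h \<Longrightarrow> g v y = g x (f y)"
    using onb_riesz[OF assms(1) linear_compose[OF assms(2) linear_g_right], of x] by auto
  then have "adjoint_on h g f x = v"
    unfolding adjoint_on_def by (intro onb_the_eq[OF assms(1)]) auto
  then show "adjoint_on h g f x \<in> h" "y \<in> h \<Longrightarrow> g (adjoint_on h g f x) y = g x (f y)"
    using v by auto
qed

section \<open>Existence of orthonormal bases\<close>

lemma orthonormal_finite:
  assumes "finite S" "B \<subseteq> span S" "orthonormal B"
  shows "finite B" "card B \<le> card S"
  using independent_span_bound[OF assms(1) orthonormal_independent[OF assms(3)] assms(2)] by auto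

text \<open>A maximal orthonormal subset of \<open>h\<close> spans \<open>h\<close>: on its orthogonal complement in \<open>h\<close> the form
  would otherwise be nonzero, so by polarisation the complement would contain a non-null vector.\<close>

lemma ex_onb:
  assumes h: "subspace h" and S: "finite S" "h \<subseteq> span S"
    and nondeg: "\<And>x. x \<in> h \<Longrightarrow> (\<And>y. y \<in> h \<Longrightarrow> g x y = 0) \<Longrightarrow> x = 0"
  shows "\<exists>B. onb h B"
proof -
  let ?P = "\<lambda>B. B \<subseteq> h \<and> orthonormal B"
  have P0: "?P {}" by (simp add: orthonormal_def)
  have bound: "card B \<le> card S" "finite B" if "?P B" for B
    using orthonormal_finite[OF S(1)] that S(2) by (meson order_trans)+
  have "\<exists>B. ?P B \<and> (\<forall>C. ?P C \<longrightarrow> card C \<le> card B)"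
    by (rule ex_has_greatest_nat[of ?P "{}" card "Suc (card S)"])
      (use P0 bound(1) le_imp_less_Suc in blast)+
  then obtain B where B: "?P B" and max: "\<And>C. ?P C \<Longrightarrow> card C \<le> card B"
    by blast
  have fin: "finite B" using B bound by auto
  have sub: "span B \<subseteq> h" using B h by (simp add: span_minimal)
  \<comment> \<open>\<open>pr\<close> is the orthogonal projection onto the complement of
    \<open>span B\<close>; once it vanishes on \<open>h\<close>, \<open>B\<close> spans
    \<open>h\<close>.\<close>
  define pr where "pr x = x - (\<Sum>e\<in>B. (g e e * g x e) *\<^sub>R e)" for x
  have pr_orth: "g (pr x) e = 0" if "e \<in> B" for x e
    using orthonormal_coeff[OF _ fin that, of "\<lambda>e. g e e * g x e"] orthonormal_square[of B e] B that
    unfolding pr_def by (simp add: mult.commute mult.left_commute)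
  have span_sum_in: "(\<Sum>e\<in>B. c e *\<^sub>R e) \<in> span B" for c
    by (intro span_sum span_mul span_base)
  have pr_h: "pr x \<in> h" if "x \<in> h" for x
    unfolding pr_def by (intro subspace_diff[OF h that] subsetD[OF sub] span_sum_in)
  have null: "g w w = 0" if w: "w \<in> h" "\<And>e. e \<in> B \<Longrightarrow> g w e = 0" for w
  proof (rule ccontr)
    assume nz: "g w w \<noteq> 0"
    define u where "u = (1 / sqrt \<bar>g w w\<bar>) *\<^sub>R w"
    have "g u u = g w w / \<bar>g w w\<bar>" using nz unfolding u_def
      by (simp add: field_simps)
    then have u: "g u u = 1 \<or> g u u = -1" using nz by (auto simp: abs_if)
    have orth: "g u e = 0" "g e u = 0" if "e \<in> B" for e
      using w(2)[OF that] g_commute[of e w] unfolding u_def by auto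
    have "u \<notin> B" using orth u by force
    moreover have "u \<in> h" using w(1) h unfolding u_def by (simp add: subspace_scale)
    then have "?P (insert u B)"
      using B orth u unfolding orthonormal_def by auto
    then have "card (insert u B) \<le> card B" by (rule max)
    ultimately show False using fin by simp
  qed
  have "h \<subseteq> span B"
  proof
    fix x assume x: "x \<in> h"
    have "pr x = 0"
    proof (rule nondeg[OF pr_h[OF x]])
      fix z assume z: "z \<in> h"
      have "g (pr x) z = g (pr x) (pr z)" unfolding pr_def[of z] by (simp add: pr_orth)
      also have "\<dots> = (g (pr x + pr z) (pr x + pr z) - g (pr x) (pr x) - g (pr z) (pr z)) / 2"
        using g_commute[of "pr x" "pr z"] by simp
      also have "\<dots> = 0"
        using null[of "pr x + pr z"] null[of "pr x"] null[of "pr z"] pr_h x z pr_orth h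
        by (simp add: subspace_add)
      finally show "g (pr x) z = 0" .
    qed
    then show "x \<in> span B" unfolding pr_def using span_sum_in by (metis eq_iff_diff_eq_0)
  qed
  then show ?thesis using sub B fin unfolding onb_def by blast
qed

section \<open>Traces in an orthonormal basis\<close>

definition tr :: "'v set \<Rightarrow> ('v \<Rightarrow> 'v) \<Rightarrow> real" where
  "tr B f = (\<Sum>e\<in>B. g e e * g (f e) e)"

lemma trace_on_cong:
  assumes "onb h B" "\<And>x. x \<in> h \<Longrightarrow> f x = f' x"
  shows "trace_on h f = trace_on h f'"
proof -
  have "\<exists>C. independent C \<and> span C = h"
    using assms(1) orthonormal_independent unfolding onb_def by blast
  then have "span (SOME C. independent C \<and> span C = h) = h"
    by (rule someI2_ex) simp
  then have "b \<in> h" if "b \<in> (SOME C. independent C \<and> span C = h)" for b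
    using that span_base by blast
  then show ?thesis unfolding trace_on_def Let_def using assms(2) by (simp cong: sum.cong)
qed

text \<open>\<open>trace_on\<close> uses some unspecified basis \<open>C\<close>. Expanding
  \<open>f b\<close> in \<open>B\<close> and each vector of \<open>B\<close> in \<open>C\<close>
  turns both traces into the same double sum.\<close>

lemma trace_on_eq_tr_linear:
  assumes onb: "onb h B" and lin: "linear f" and fh: "\<And>x. x \<in> h \<Longrightarrow> f x \<in> h"
  shows "trace_on h f = tr B f"
proof -
  define C where "C = (SOME C. independent C \<and> span C = h)"
  have "\<exists>C. independent C \<and> span C = h"
    using onb orthonormal_independent unfolding onb_def by blast
  then have C: "independent C" "span C = h"
    unfolding C_def by (metis (mono_tags, lifting) someI_ex)+
  have finB: "finite B" using onb unfolding onb_def by simp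
  have "C \<subseteq> span B" using C span_superset onb unfolding onb_def by blast
  then have finC: "finite C" using independent_span_bound[OF finB C(1)] by blast
  have e_rep: "e = (\<Sum>b\<in>C. representation C e b *\<^sub>R b)" if "e \<in> B" for e
    using real_vector.sum_representation_eq[OF C(1) _ finC order_refl, of e] onb_in[OF onb that] C(2)
    by simp
  have "representation C (f b) b = (\<Sum>e\<in>B. g e e * g (f b) e * representation C e b)" if "b \<in> C" for b
  proof -
    have "b \<in> h" using that C span_base by blast
    then have "representation C (f b) = representation C (\<Sum>e\<in>B. (g e e * g (f b) e) *\<^sub>R e)"
      using onb_expand[OF onb fh] by metis
    also have "\<dots> = (\<lambda>b'. \<Sum>e\<in>B. representation C ((g e e * g (f b) e) *\<^sub>R e) b')"
      using C onb_in[OF onb] by (intro real_vector.representation_sum) (auto simp: span_mul)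
    also have "\<dots> = (\<lambda>b'. \<Sum>e\<in>B. (g e e * g (f b) e) * representation C e b')"
      using C onb_in[OF onb] by (intro ext sum.cong) (auto simp: real_vector.representation_scale)
    finally show ?thesis by simp
  qed
  then have "trace_on h f = (\<Sum>b\<in>C. \<Sum>e\<in>B. g e e * g (f b) e * representation C e b)"
    unfolding trace_on_def Let_def C_def[symmetric] by simp
  also have "\<dots> = (\<Sum>e\<in>B. \<Sum>b\<in>C. g e e * g (f b) e * representation C e b)"
    by (rule sum.swap)
  also have "\<dots> = (\<Sum>e\<in>B. g e e * g (f (\<Sum>b\<in>C. representation C e b *\<^sub>R b)) e)"
    by (simp add: linear_sum[OF lin] linear_scale[OF lin] sum_distrib_left mult_ac)
  also have "\<dots> = tr B f" unfolding tr_def using e_rep by (metis (mono_tags, lifting) sum.cong)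
  finally show ?thesis .
qed

text \<open>\<open>curvature\<close> is known to be linear only on \<open>h\<close>, because the
  connection is \<open>0\<close> outside. Its trace is therefore computed from a map that is linear
  everywhere and agrees with it on \<open>h\<close>.\<close>

lemma trace_on_eq_tr:
  assumes "onb h B" "linear f'" "\<And>x. x \<in> h \<Longrightarrow> f' x \<in> h" "\<And>x. x \<in> h \<Longrightarrow> f x = f' x"
  shows "trace_on h f = tr B f'"
  using trace_on_cong[OF assms(1,4)] trace_on_eq_tr_linear[OF assms(1-3)] by simp

lemma tr_comp:
  assumes onb: "onb h B" and lin: "linear f" and kh: "\<And>x. x \<in> h \<Longrightarrow> k x \<in> h"
  shows "tr B (\<lambda>x. f (k x)) = (\<Sum>e\<in>B. \<Sum>e'\<in>B. g e e * g e' e' * (g (k e) e' * g (f e') e))"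
  unfolding tr_def
proof (intro sum.cong refl)
  fix e assume e: "e \<in> B"
  have "f (k e) = f (\<Sum>e'\<in>B. (g e' e' * g (k e) e') *\<^sub>R e')"
    using onb_expand[OF onb kh[OF onb_in[OF onb e]]] by simp
  then have "f (k e) = (\<Sum>e'\<in>B. (g e' e' * g (k e) e') *\<^sub>R f e')"
    by (simp add: linear_sum[OF lin] linear_scale[OF lin])
  then show "g e e * g (f (k e)) e = (\<Sum>e'\<in>B. g e e * g e' e' * (g (k e) e' * g (f e') e))"
    by (simp add: sum_distrib_left mult_ac)
qed

lemma tr_commute:
  assumes "onb h B" "linear f" "linear k" "\<And>x. x \<in> h \<Longrightarrow> f x \<in> h" "\<And>x. x \<in> h \<Longrightarrow> k x \<in> h"
  shows "tr B (\<lambda>x. f (k x)) = tr B (\<lambda>x. k (f x))"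
proof -
  have "tr B (\<lambda>x. f (k x)) = (\<Sum>e\<in>B. \<Sum>e'\<in>B. g e e * g e' e' * (g (k e) e' * g (f e') e))"
    by (rule tr_comp[OF assms(1,2,5)])
  also have "\<dots> = (\<Sum>e'\<in>B. \<Sum>e\<in>B. g e e * g e' e' * (g (k e) e' * g (f e') e))"
    by (rule sum.swap)
  also have "\<dots> = (\<Sum>e'\<in>B. \<Sum>e\<in>B. g e' e' * g e e * (g (f e') e * g (k e) e'))"
    by (simp add: mult.commute)
  also have "\<dots> = tr B (\<lambda>x. k (f x))"
    by (rule tr_comp[OF assms(1,3,4), symmetric])
  finally show ?thesis .
qed

lemma tr_add: "tr B (\<lambda>x. f x + k x) = tr B f + tr B k"
  unfolding tr_def by (simp add: ring_distribs sum.distrib)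

lemma tr_scale: "tr B (\<lambda>x. r *\<^sub>R f x) = r * tr B f"
  unfolding tr_def by (simp add: sum_distrib_left mult_ac)

lemma tr_diff: "tr B (\<lambda>x. f x - k x) = tr B f - tr B k"
  unfolding tr_def by (simp add: right_diff_distrib sum_subtractf)

end

section \<open>The Ricci tensor of a metric Lie algebra\<close>

locale metric_lie = scalar_product g for g :: "'v::real_vector \<Rightarrow> 'v \<Rightarrow> real" +
  fixes br :: "'v \<Rightarrow> 'v \<Rightarrow> 'v"
  assumes bilinear_br: "bilinear br"
    and br_self [simp]: "br x x = 0"
    and jacobi: "br x (br y z) + br y (br z x) + br z (br x y) = 0"
begin

lemma linear_br_left: "linear (\<lambda>x. br x y)" and linear_br_right: "linear (br x)"
  using bilinear_br unfolding bilinear_def by auto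

lemma br_add [simp]: "br (x + y) z = br x z + br y z" "br z (x + y) = br z x + br z y"
  using bilinear_br by (auto simp: bilinear_ladd bilinear_radd)

lemma br_diff [simp]: "br (x - y) z = br x z - br y z" "br z (x - y) = br z x - br z y"
  using bilinear_br by (auto simp: bilinear_lsub bilinear_rsub)

lemma br_minus [simp]: "br (- x) z = - br x z" "br z (- x) = - br z x"
  using bilinear_br by (auto simp: bilinear_lneg bilinear_rneg)

lemma br_scale [simp]: "br (r *\<^sub>R x) z = r *\<^sub>R br x z" "br z (r *\<^sub>R x) = r *\<^sub>R br z x"
  using bilinear_br by (auto simp: bilinear_lmul bilinear_rmul)

lemma br_zero [simp]: "br 0 z = 0" "br z 0 = 0"
  using bilinear_br by (auto simp: bilinear_lzero bilinear_rzero)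

lemma br_antisym: "br x y = - br y x"
proof -
  have "br (x + y) (x + y) = br x y + br y x" by (simp del: br_self) simp
  then show ?thesis by (simp add: eq_neg_iff_add_eq_0)
qed

lemma br_br: "br (br x y) z = br x (br y z) - br y (br x z)"
  using jacobi[of x y z] br_antisym[of z "br x y"] br_antisym[of z x] by simp

lemma br_span_closed:
  assumes "X \<in> span S" "Y \<in> span T" "\<And>a e. a \<in> S \<Longrightarrow> e \<in> T \<Longrightarrow> br a e \<in> span U"
  shows "br X Y \<in> span U"
proof -
  have "br a Y \<in> span U" if "a \<in> S" for a
    using assms(2)
  proof (induction rule: span_induct_alt)
    case (step c e y) then show ?case using assms(3)[OF that] by (simp add: span_add span_scale)
  qed (simp add: span_zero)
  note 1 = this
  show ?thesis using assms(1)
  proof (induction rule: span_induct_alt)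
    case (step c a y) then show ?case using 1 by (simp add: span_add span_scale)
  qed (simp add: span_zero)
qed

section \<open>The Koszul form and the Levi-Civita connection\<close>

definition subalgebra :: "'v set \<Rightarrow> bool" where
  "subalgebra h \<longleftrightarrow> (\<forall>x\<in>h. \<forall>y\<in>h. br x y \<in> h)"

text \<open>The Koszul formula for the product of \<open>\<nabla>_X Y\<close> with \<open>Z\<close>
  on left-invariant fields, where the terms that differentiate scalar products vanish.\<close>

definition koszul :: "'v \<Rightarrow> 'v \<Rightarrow> 'v \<Rightarrow> real" where
  "koszul X Y Z = (g (br X Y) Z - g (br Y Z) X + g (br Z X) Y) / 2"

text \<open>The vector of \<open>span B\<close> that represents the Koszul form. It is linear in
  both arguments on the whole space, unlike \<open>levi_civita\<close>, which is cut off to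
  \<open>0\<close> outside \<open>h\<close>.\<close>

definition nabla :: "'v set \<Rightarrow> 'v \<Rightarrow> 'v \<Rightarrow> 'v" where
  "nabla B X Y = (\<Sum>e\<in>B. (g e e * koszul X Y e) *\<^sub>R e)"

lemma koszul_add: "koszul (X + X') Y Z = koszul X Y Z + koszul X' Y Z"
    "koszul X (Y + Y') Z = koszul X Y Z + koszul X Y' Z"
    "koszul X Y (Z + Z') = koszul X Y Z + koszul X Y Z'"
  and koszul_scale: "koszul (r *\<^sub>R X) Y Z = r * koszul X Y Z"
    "koszul X (r *\<^sub>R Y) Z = r * koszul X Y Z"
    "koszul X Y (r *\<^sub>R Z) = r * koszul X Y Z"
  unfolding koszul_def by (simp_all add: field_simps)

lemma linear_koszul: "linear (koszul X Y)"
  by (rule linearI) (auto simp: koszul_add koszul_scale)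

lemma linear_nabla_left: "linear (\<lambda>X. nabla B X Y)"
  and linear_nabla_right: "linear (\<lambda>Y. nabla B X Y)"
  by (rule linearI; simp add: nabla_def koszul_add koszul_scale ring_distribs scaleR_add_left
      sum.distrib scaleR_sum_right mult_ac)+

lemma nabla_in: "onb h B \<Longrightarrow> nabla B X Y \<in> h"
  unfolding nabla_def by (rule onb_sum_in)

lemma g_nabla: "onb h B \<Longrightarrow> Z \<in> h \<Longrightarrow> g (nabla B X Y) Z = koszul X Y Z"
  unfolding nabla_def by (rule onb_represent[OF _ linear_koszul])

text \<open>Uniqueness half: three cyclic torsion equations and three metricity equations form a
  linear system that determines \<open>g (D X Y) Z\<close>.\<close>

lemma levi_civita_koszul:
  assumes D: "is_levi_civita h br g D" and h: "X \<in> h" "Y \<in> h" "Z \<in> h"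
  shows "g (D X Y) Z = koszul X Y Z"
proof -
  have tor: "g (D U V) W - g (D V U) W = g (br U V) W" if "U \<in> h" "V \<in> h" for U V W
    using D that g_diff(1)[of "D U V" "D V U" W] unfolding is_levi_civita_def by metis
  have met: "g (D U V) W = - g (D U W) V" if "U \<in> h" "V \<in> h" "W \<in> h" for U V W
    using D that g_commute[of V "D U W"] unfolding is_levi_civita_def
    by (metis add_eq_0_iff2)
  show ?thesis
    using tor[OF h(1,2), of Z] tor[OF h(2,3), of X] tor[OF h(3,1), of Y]
      met[OF h(1,2,3)] met[OF h(2,1,3)] met[OF h(3,1,2)]
    unfolding koszul_def by argo
qed

lemma nabla_torsion:
  assumes "onb h B" "subalgebra h" "X \<in> h" "Y \<in> h"
  shows "nabla B X Y - nabla B Y X = br X Y"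
proof (rule onb_eqI[OF assms(1)])
  show "nabla B X Y - nabla B Y X \<in> h"
    using assms nabla_in onb_subspace subspace_diff by metis
  show "br X Y \<in> h" using assms unfolding subalgebra_def by auto
  show "g (nabla B X Y - nabla B Y X) e = g (br X Y) e" if "e \<in> B" for e
    using assms(1) onb_in[OF assms(1) that] br_antisym[of Y e] br_antisym[of e X] br_antisym[of Y X]
    by (simp add: g_nabla koszul_def field_simps)
qed

lemma levi_civita_eq_nabla:
  assumes onb: "onb h B" and sub: "subalgebra h" and h: "X \<in> h" "Y \<in> h"
  shows "levi_civita h br g X Y = nabla B X Y"
proof -
  \<comment> \<open>\<open>is_levi_civita\<close> demands the value \<open>0\<close> outside
    \<open>h\<close>, so \<open>nabla\<close> has to be cut off to satisfy it.\<close>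
  let ?D = "\<lambda>X Y. if X \<in> h \<and> Y \<in> h then nabla B X Y else 0"
  note sp = onb_subspace[OF onb]
  have lc: "is_levi_civita h br g ?D"
    unfolding is_levi_civita_def
  proof (intro conjI ballI allI impI)
    fix X Y Z r assume h: "X \<in> h" "Y \<in> h" "Z \<in> h"
    show "?D (r *\<^sub>R X + Y) Z = r *\<^sub>R ?D X Z + ?D Y Z"
      using h sp linear_add[OF linear_nabla_left] linear_scale[OF linear_nabla_left]
      by (simp add: subspace_add subspace_scale)
    show "?D X (r *\<^sub>R Y + Z) = r *\<^sub>R ?D X Y + ?D X Z"
      using h sp linear_add[OF linear_nabla_right] linear_scale[OF linear_nabla_right]
      by (simp add: subspace_add subspace_scale)
    show "g (?D X Y) Z + g Y (?D X Z) = 0"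
      using h onb g_commute[of Y "nabla B X Z"]
        br_antisym[of Z X] br_antisym[of Z Y] br_antisym[of Y X]
      by (simp add: g_nabla koszul_def field_simps)
  qed (use onb sub nabla_in nabla_torsion in auto)
  have "levi_civita h br g = ?D"
    unfolding levi_civita_def
  proof (rule the_equality)
    show "is_levi_civita h br g ?D" by (rule lc)
    fix D assume D: "is_levi_civita h br g D"
    have "D X Y = ?D X Y" for X Y
    proof (cases "X \<in> h \<and> Y \<in> h")
      case True
      then have "D X Y \<in> h" using D unfolding is_levi_civita_def by blast
      then have "D X Y = nabla B X Y"
        using True levi_civita_koszul[OF D] g_nabla[OF onb] onb_in[OF onb] nabla_in[OF onb]
        by (intro onb_eqI[OF onb]) auto
      then show ?thesis using True by simp
    next
      case False
      then show ?thesis using D unfolding is_levi_civita_def by (metis (full_types))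
    qed
    then show "D = ?D" by blast
  qed
  then show ?thesis using h by simp
qed

section \<open>The Ricci tensor as a trace\<close>

lemma curvature_eq_nabla:
  assumes "onb h B" "subalgebra h" "X \<in> h" "Y \<in> h" "W \<in> h"
  shows "curvature h br g X Y W
    = nabla B X (nabla B Y W) - nabla B Y (nabla B X W) - nabla B (br X Y) W"
  using assms nabla_in[OF assms(1)] levi_civita_eq_nabla[OF assms(1,2)]
  unfolding curvature_def Let_def subalgebra_def by simp

lemma ric_eq_tr:
  assumes onb: "onb h B" and sub: "subalgebra h" and h: "Y \<in> h" "W \<in> h"
  shows "ric h br g Y W
    = tr B (\<lambda>X. nabla B X (nabla B Y W) - nabla B Y (nabla B X W) - nabla B (br X Y) W)"
  unfolding ric_def
proof (rule trace_on_eq_tr[OF onb])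
  show "linear (\<lambda>X. nabla B X (nabla B Y W) - nabla B Y (nabla B X W) - nabla B (br X Y) W)"
    by (intro linear_compose_sub linear_nabla_left
        linear_compose[unfolded o_def, OF linear_nabla_left linear_nabla_right]
        linear_compose[unfolded o_def, OF linear_br_left linear_nabla_left])
  show "nabla B X (nabla B Y W) - nabla B Y (nabla B X W) - nabla B (br X Y) W \<in> h" for X
    by (intro subspace_diff onb_subspace[OF onb] nabla_in[OF onb])
qed (use curvature_eq_nabla[OF onb sub] h in auto)

text \<open>Writing \<open>\<phi>_Y X = \<nabla>_X Y\<close>, torsion-freeness gives \<open>\<nabla>_Y = ad Y + \<phi>_Y\<close>, and cyclicity of the trace
  then cancels the mixed terms in \<open>tr (X \<mapsto> R(X, Y) W)\<close>, leaving \<open>- tr ad (\<nabla>_Y W) - tr (\<phi>_Y \<phi>_W)\<close>.\<close>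

lemma ric_eq_tr_shape:
  assumes onb: "onb h B" and sub: "subalgebra h" and h: "Y \<in> h" "W \<in> h"
  shows "ric h br g Y W
    = - tr B (br (nabla B Y W)) - tr B (\<lambda>X. nabla B (nabla B X W) Y)"
proof -
  have lin: "linear (\<lambda>X. nabla B X W)" "linear (br Y)"
    by (rule linear_nabla_left linear_br_right)+
  have brh: "br Y x \<in> h" if "x \<in> h" for x using that h sub unfolding subalgebra_def by auto
  \<comment> \<open>On the diagonal \<open>koszul e V e\<close> reduces to
    \<open>- g (br V e) e\<close>, as \<open>br e e = 0\<close>; here
    \<open>V = nabla B Y W\<close>.\<close>
  have 1: "tr B (\<lambda>X. nabla B X (nabla B Y W)) = - tr B (br (nabla B Y W))"
    unfolding tr_def sum_negf[symmetric]
    by (intro sum.cong refl)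
      (auto simp: g_nabla[OF onb onb_in[OF onb]] koszul_def br_antisym[of _ "nabla B Y W"])
  have "tr B (\<lambda>X. nabla B (br X Y) W) = - tr B (\<lambda>X. nabla B (br Y X) W)"
    unfolding tr_def sum_negf[symmetric]
    by (intro sum.cong refl)
      (simp add: br_antisym[of _ Y] linear_neg[OF linear_nabla_left])
  also have "tr B (\<lambda>X. nabla B (br Y X) W) = tr B (\<lambda>X. br Y (nabla B X W))"
    using lin nabla_in[OF onb] brh by (intro tr_commute[OF onb]) auto
  finally have 2: "tr B (\<lambda>X. nabla B (br X Y) W) = - tr B (\<lambda>X. br Y (nabla B X W))" .
  have 3: "tr B (\<lambda>X. nabla B Y (nabla B X W))
      = tr B (\<lambda>X. br Y (nabla B X W)) + tr B (\<lambda>X. nabla B (nabla B X W) Y)"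
    unfolding tr_def sum.distrib[symmetric]
  proof (intro sum.cong refl)
    fix e
    have "nabla B Y (nabla B e W) = br Y (nabla B e W) + nabla B (nabla B e W) Y"
      using nabla_torsion[OF onb sub h(1) nabla_in[OF onb, of e W]] by (simp add: algebra_simps)
    then show "g e e * g (nabla B Y (nabla B e W)) e
      = g e e * g (br Y (nabla B e W)) e + g e e * g (nabla B (nabla B e W) Y) e"
      by (simp add: ring_distribs)
  qed
  show ?thesis unfolding ric_eq_tr[OF assms] tr_diff using 1 2 3 by simp
qed

text \<open>In the basis \<open>B\<close>, \<open>X \<mapsto> \<nabla>_X W\<close> is minus the
  symmetric part of \<open>ad W\<close> plus an antisymmetric part with entries
  \<open>g (br f e) W / 2\<close>. In the trace of a product of two such maps the mixed terms
  vanish; the symmetric parts give the first two summands and the antisymmetric parts the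
  last.\<close>

lemma tr_shape:
  assumes onb: "onb h B" and sub: "subalgebra h" and h: "Y \<in> h" "W \<in> h"
  shows "tr B (\<lambda>X. nabla B (nabla B X W) Y)
    = (\<Sum>e\<in>B. g e e * g (br Y e) (br W e)) / 2 + tr B (\<lambda>X. br Y (br W X)) / 2
      - (\<Sum>e\<in>B. \<Sum>f\<in>B. g e e * g f f * g (br e f) Y * g (br e f) W) / 4"
proof -
  let ?y = "\<lambda>e f. g (br Y e) f" and ?w = "\<lambda>e f. g (br W e) f"
  let ?cy = "\<lambda>e f. g (br e f) Y" and ?cw = "\<lambda>e f. g (br e f) W"
  let ?S = "\<lambda>t. \<Sum>e\<in>B. \<Sum>f\<in>B. g e e * g f f * t e f"
  have swap: "?S t = ?S (\<lambda>e f. t f e)" for t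
    by (subst sum.swap) (simp add: mult_ac)
  have S_add: "?S (\<lambda>e f. t e f + t' e f) = ?S t + ?S t'" for t t'
    by (simp add: ring_distribs sum.distrib)
  have S_cmul: "?S (\<lambda>e f. c * t e f) = c * ?S t" for c t
    by (simp add: sum_distrib_left mult_ac)
  have c_anti: "?cy e f = - ?cy f e" "?cw e f = - ?cw f e" for e f
    using br_antisym[of e f] by simp_all
  have brh: "br V x \<in> h" if "x \<in> h" "V \<in> h" for x V using that sub unfolding subalgebra_def by auto
  have "tr B (\<lambda>X. nabla B (nabla B X W) Y)
      = (\<Sum>e\<in>B. \<Sum>f\<in>B. g e e * g f f * (g (nabla B e W) f * g (nabla B f Y) e))"
    by (rule tr_comp[OF onb linear_nabla_left nabla_in[OF onb]])
  also have "\<dots> = ?S (\<lambda>e f. (1/4) * ((- ?w e f - ?w f e + ?cw f e) * (- ?y f e - ?y e f + ?cy e f)))"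
    using br_antisym[of _ W] br_antisym[of _ Y]
    by (intro sum.cong refl) (simp add: g_nabla[OF onb onb_in[OF onb]] koszul_def)
  also have "\<dots> = ?S (\<lambda>e f. (1/4) * (?w e f * ?y e f) + ((1/4) * (?w f e * ?y f e)
      + ((1/4) * (?w e f * ?y f e) + ((1/4) * (?w f e * ?y e f) + ((- 1/4) * (?cy e f * ?cw e f)
      + ((- 1/4) * (?cy e f * (?w e f + ?w f e)) + (1/4) * (?cw e f * (?y e f + ?y f e))))))))"
  proof (intro sum.cong refl arg_cong2[where f = "(*)"])
    fix e f
    show "(1/4) * ((- ?w e f - ?w f e + ?cw f e) * (- ?y f e - ?y e f + ?cy e f))
      = (1/4) * (?w e f * ?y e f) + ((1/4) * (?w f e * ?y f e)
      + ((1/4) * (?w e f * ?y f e) + ((1/4) * (?w f e * ?y e f) + ((- 1/4) * (?cy e f * ?cw e f)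
      + ((- 1/4) * (?cy e f * (?w e f + ?w f e)) + (1/4) * (?cw e f * (?y e f + ?y f e)))))))"
      unfolding c_anti(2)[of f e] by (simp add: field_simps)
  qed
  also have "\<dots> = (1/2) * ?S (\<lambda>e f. ?w e f * ?y e f) + (1/2) * ?S (\<lambda>e f. ?w e f * ?y f e)
      - (1/4) * ?S (\<lambda>e f. ?cy e f * ?cw e f) - (1/4) * ?S (\<lambda>e f. ?cy e f * (?w e f + ?w f e))
      + (1/4) * ?S (\<lambda>e f. ?cw e f * (?y e f + ?y f e))"
    unfolding S_add S_cmul
    using swap[of "\<lambda>e f. ?w e f * ?y e f"] swap[of "\<lambda>e f. ?w e f * ?y f e"] by linarith
  also have "?S (\<lambda>e f. ?cy e f * (?w e f + ?w f e)) = 0"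
  proof -
    have "?S (\<lambda>e f. ?cy e f * (?w e f + ?w f e)) = ?S (\<lambda>e f. (-1) * (?cy e f * (?w e f + ?w f e)))"
    proof -
      have pt: "(-1) * (?cy e f * (?w e f + ?w f e)) = ?cy f e * (?w f e + ?w e f)" for e f
        unfolding c_anti(1)[of f e] by (simp add: add.commute)
      show ?thesis unfolding pt by (rule swap)
    qed
    then show ?thesis unfolding S_cmul by simp
  qed
  also have "?S (\<lambda>e f. ?cw e f * (?y e f + ?y f e)) = 0"
  proof -
    have "?S (\<lambda>e f. ?cw e f * (?y e f + ?y f e)) = ?S (\<lambda>e f. (-1) * (?cw e f * (?y e f + ?y f e)))"
    proof -
      have pt: "(-1) * (?cw e f * (?y e f + ?y f e)) = ?cw f e * (?y f e + ?y e f)" for e f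
        unfolding c_anti(2)[of f e] by (simp add: add.commute)
      show ?thesis unfolding pt by (rule swap)
    qed
    then show ?thesis unfolding S_cmul by simp
  qed
  also have "?S (\<lambda>e f. ?w e f * ?y f e) = tr B (\<lambda>X. br Y (br W X))"
    by (rule tr_comp[OF onb linear_br_right brh[OF _ h(2)], symmetric])
  also have "?S (\<lambda>e f. ?w e f * ?y e f) = (\<Sum>e\<in>B. g e e * g (br Y e) (br W e))"
  proof (intro sum.cong refl)
    fix e assume "e \<in> B"
    then have "br Y e \<in> h" using brh onb_in[OF onb] h by blast
    from onb_expand_g[OF onb this, of "br W e"]
    show "(\<Sum>f\<in>B. g e e * g f f * (?w e f * ?y e f)) = g e e * g (br Y e) (br W e)"
      by (simp add: sum_distrib_left[symmetric] mult.assoc g_commute[of _ "br W e"] mult.commute[of "?w e _"])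
  qed
  finally show ?thesis by (simp add: mult.assoc)
qed

section \<open>The general Ricci formula\<close>

lemma tr_br:
  assumes onb: "onb h B" and sub: "subalgebra h" and h: "Y \<in> h" "W \<in> h"
  shows "tr B (br (br Y W)) = 0"
proof -
  have brh: "br V x \<in> h" if "x \<in> h" "V \<in> h" for x V using that sub unfolding subalgebra_def by auto
  have "tr B (br (br Y W)) = tr B (\<lambda>X. br Y (br W X) - br W (br Y X))"
    unfolding tr_def by (simp only: br_br)
  also have "\<dots> = 0"
    unfolding tr_diff using tr_commute[OF onb linear_br_right linear_br_right, of Y W] brh h by simp
  finally show ?thesis .
qed

text \<open>For a nilpotent algebra this is the whole Ricci tensor; in general the Killing form and
  the mean curvature vector contribute further terms.\<close>

definition ricci_nil :: "'v set \<Rightarrow> 'v \<Rightarrow> 'v \<Rightarrow> real" where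
  "ricci_nil B X Y = (\<Sum>e\<in>B. \<Sum>f\<in>B. g e e * g f f * g (br e f) X * g (br e f) Y) / 4
    - (\<Sum>e\<in>B. g e e * g (br X e) (br Y e)) / 2"

lemma ricci_nil_commute: "ricci_nil B X Y = ricci_nil B Y X"
  unfolding ricci_nil_def by (simp add: g_commute[of "br X _"] mult_ac)

lemma linear_ricci_nil: "linear (ricci_nil B X)"
proof (rule linearI)
  show "ricci_nil B X (y + z) = ricci_nil B X y + ricci_nil B X z" for y z
    unfolding ricci_nil_def by (simp add: ring_distribs sum.distrib add_divide_distrib)
  show "ricci_nil B X (r *\<^sub>R y) = r *\<^sub>R ricci_nil B X y" for r y
    unfolding ricci_nil_def by (simp add: right_diff_distrib sum_distrib_left mult_ac)
qed

text \<open>\<open>tr ad (\<nabla>_Y W)\<close> is the product of \<open>\<nabla>_Y W\<close> with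
  \<open>H\<close>, hence a Koszul form. By \<open>tr_br\<close>, \<open>H\<close> is orthogonal to
  \<open>br Y W\<close>, so only the symmetric part of \<open>ad H\<close> survives.\<close>

lemma ric_formula:
  assumes onb: "onb h B" and sub: "subalgebra h" and h: "Y \<in> h" "W \<in> h"
    and H: "H \<in> h" "\<And>X. X \<in> h \<Longrightarrow> g H X = tr B (br X)"
  shows "ric h br g Y W = ricci_nil B Y W - tr B (\<lambda>X. br Y (br W X)) / 2
    - (g (br H Y) W + g (br H W) Y) / 2"
proof -
  have "tr B (br (nabla B Y W)) = koszul Y W H"
    using g_nabla[OF onb H(1), of Y W] H(2)[OF nabla_in[OF onb]] g_commute by metis
  also have "\<dots> = (g H (br Y W) - g (br W H) Y + g (br H Y) W) / 2"
    unfolding koszul_def by (simp add: g_commute)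
  also have "g H (br Y W) = 0"
    using H(2) tr_br[OF onb sub h] h sub unfolding subalgebra_def by simp
  finally show ?thesis
    unfolding ric_eq_tr_shape[OF onb sub h] tr_shape[OF onb sub h] ricci_nil_def
    using br_antisym[of W H] by (simp add: field_simps)
qed

end

section \<open>Ricci curvature of an Iwasawa splitting\<close>

text \<open>The grading element \<open>A0\<close> need not lie in \<open>span Ba\<close>: for \<open>\<s>'\<close> we use the one of \<open>\<s>\<close>.\<close>

locale iwasawa_split = metric_lie g br
  for g :: "'v::real_vector \<Rightarrow> 'v \<Rightarrow> real" and br :: "'v \<Rightarrow> 'v \<Rightarrow> 'v" +
  fixes Ba Bn :: "'v set" and A0 :: 'v and w :: "'v \<Rightarrow> real"
  assumes fin: "finite Ba" "finite Bn"
    and disj: "Ba \<inter> Bn = {}"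
    and orthonormal: "orthonormal (Ba \<union> Bn)"
    and a_abelian: "\<And>A C. A \<in> span Ba \<Longrightarrow> C \<in> span Ba \<Longrightarrow> br A C = 0"
    and a_diag: "\<And>A e. A \<in> span Ba \<Longrightarrow> e \<in> Bn \<Longrightarrow> \<exists>c. br A e = c *\<^sub>R e"
    and n_closed: "\<And>e f. e \<in> Bn \<Longrightarrow> f \<in> Bn \<Longrightarrow> br e f \<in> span Bn"
    and a_sym: "\<And>A x y. A \<in> span Ba \<Longrightarrow> g (br A x) y = g x (br A y)"
    and A0_sym: "\<And>x y. g (br A0 x) y = g x (br A0 y)"
    and A0_weight: "\<And>e. e \<in> Bn \<Longrightarrow> br A0 e = w e *\<^sub>R e"
    and weight_pos: "\<And>e. e \<in> Bn \<Longrightarrow> w e > 0"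
begin

definition h where "h = span (Ba \<union> Bn)"

lemma onb_h: "onb h (Ba \<union> Bn)" and onb_a: "onb (span Ba) Ba" and onb_n: "onb (span Bn) Bn"
  using fin orthonormal unfolding onb_def h_def orthonormal_def by auto

lemma a_sub_h: "A \<in> span Ba \<Longrightarrow> A \<in> h" and n_sub_h: "X \<in> span Bn \<Longrightarrow> X \<in> h"
  unfolding h_def using span_mono[of Ba "Ba \<union> Bn"] span_mono[of Bn "Ba \<union> Bn"] by auto

lemma h_cases:
  assumes "x \<in> h"
  obtains A X where "A \<in> span Ba" "X \<in> span Bn" "x = A + X"
  using assms unfolding h_def span_Un by blast

lemma a_ortho_n: "A \<in> span Ba \<Longrightarrow> X \<in> span Bn \<Longrightarrow> g A X = 0"
proof (erule (1) span_ortho)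
  fix a e assume "a \<in> Ba" "e \<in> Bn"
  moreover from this have "a \<noteq> e" using disj by auto
  ultimately show "g a e = 0" using orthonormal unfolding orthonormal_def by simp
qed

lemma n_sub: "X \<in> span Bn \<Longrightarrow> Y \<in> span Bn \<Longrightarrow> br X Y \<in> span Bn"
  by (rule br_span_closed[OF _ _ n_closed])

lemma a_n: "A \<in> span Ba \<Longrightarrow> X \<in> span Bn \<Longrightarrow> br A X \<in> span Bn"
  by (rule br_span_closed[of A "span Ba" X Bn])
    (use a_diag in \<open>fastforce intro: span_base span_scale simp: span_span\<close>)+

lemma br_h_n: "x \<in> h \<Longrightarrow> y \<in> h \<Longrightarrow> br x y \<in> span Bn"
proof (elim h_cases)
  fix A X C Y assume "A \<in> span Ba" "C \<in> span Ba" "X \<in> span Bn" "Y \<in> span Bn"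
    and "x = A + X" "y = C + Y"
  then show "br x y \<in> span Bn"
    using a_abelian[of A C] a_n[of A Y] a_n[of C X] n_sub[of X Y] br_antisym[of X C]
    by (simp add: span_add span_diff)
qed

lemma subalgebra_h: "subalgebra h" and subalgebra_n: "subalgebra (span Bn)"
  unfolding subalgebra_def using br_h_n n_sub n_sub_h by blast+

text \<open>A map into \<open>span Bn\<close> has no diagonal entries on \<open>Ba\<close>. Every
  \<open>ad x\<close> with \<open>x\<close> in \<open>h\<close> is of this kind, so traces over
  \<open>h\<close> become traces over \<open>span Bn\<close>.\<close>

lemma tr_h_eq_tr_n:
  assumes "\<And>x. x \<in> h \<Longrightarrow> f x \<in> span Bn"
  shows "tr (Ba \<union> Bn) f = tr Bn f"
proof -
  have "g (f e) e = 0" if "e \<in> Ba" for e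
    using a_ortho_n[OF span_base[OF that] assms] a_sub_h span_base[OF that] g_commute by metis
  then have "tr Ba f = 0" unfolding tr_def by simp
  then show ?thesis unfolding tr_def using fin disj by (simp add: sum.union_disjoint)
qed

text \<open>By linearity in \<open>X\<close> it suffices that the diagonal vanishes for basis
  vectors; the grading by \<open>A0\<close> will provide this.\<close>

lemma tr_zero_span:
  assumes "linear F" "X \<in> span Bn" "\<And>f e. f \<in> Bn \<Longrightarrow> e \<in> Bn \<Longrightarrow> g (F (br f e)) e = 0"
  shows "tr Bn (\<lambda>x. F (br X x)) = 0"
  using assms(2)
proof (induction rule: span_induct_alt)
  case base
  then show ?case using linear_0[OF assms(1)] unfolding tr_def by simp
next
  case (step c f y)
  have "tr Bn (\<lambda>x. F (br (c *\<^sub>R f + y) x)) = c * tr Bn (\<lambda>x. F (br f x)) + tr Bn (\<lambda>x. F (br y x))"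
    unfolding tr_def by (simp add: linear_add[OF assms(1)] linear_scale[OF assms(1)]
        sum.distrib sum_distrib_left algebra_simps)
  moreover have "tr Bn (\<lambda>x. F (br f x)) = 0" unfolding tr_def using assms(3) step by simp
  ultimately show ?case using step by simp
qed

section \<open>Traces killed by positive weights\<close>

lemma br_weight: "e \<in> Bn \<Longrightarrow> br A0 x = c *\<^sub>R x \<Longrightarrow> br A0 (br e x) = (w e + c) *\<^sub>R br e x"
  using br_br[of A0 e x] A0_weight[of e] by (simp add: algebra_simps)

lemma weight_ortho:
  assumes "br A0 x = c *\<^sub>R x" "br A0 y = d *\<^sub>R y" "c \<noteq> d"
  shows "g x y = 0"
proof -
  have "c * g x y = d * g x y" using A0_sym[of x y] assms by simp
  then show ?thesis using assms(3) by simp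
qed

text \<open>\<open>br f e\<close> has weight \<open>w f + w e\<close>, which exceeds
  \<open>w e\<close>, so it is orthogonal to \<open>e\<close>.\<close>

lemma tr_n_ad: "X \<in> span Bn \<Longrightarrow> tr Bn (br X) = 0"
  using tr_zero_span[of "\<lambda>x. x" X] weight_ortho[OF br_weight[OF _ A0_weight] A0_weight] weight_pos
  by (fastforce simp: linear_id[unfolded id_def])

lemma tr_n_ad_ad:
  assumes "X \<in> span Bn" "Y \<in> span Bn"
  shows "tr Bn (\<lambda>x. br X (br Y x)) = 0"
proof (rule tr_zero_span[OF linear_br_right assms(2)])
  fix f e assume fe: "f \<in> Bn" "e \<in> Bn"
  show "g (br X (br f e)) e = 0" using assms(1)
  proof (induction rule: span_induct_alt)
    case (step c k y)
    have "g (br k (br f e)) e = 0"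
      using weight_ortho[OF br_weight[OF step(1) br_weight[OF fe(1) A0_weight]] A0_weight, OF fe(2) fe(2)]
        weight_pos[OF fe(1)] weight_pos[OF step(1)] by simp
    then show ?case using step by simp
  qed simp
qed

text \<open>\<open>ad A\<close> is symmetric and diagonal on \<open>Bn\<close>, so it passes to
  \<open>e\<close> as a scalar and leaves \<open>g (br f e) e\<close>, which is \<open>0\<close> by
  weights.\<close>

lemma tr_a_ad_ad:
  assumes "A \<in> span Ba" "Y \<in> span Bn"
  shows "tr Bn (\<lambda>x. br A (br Y x)) = 0"
proof (rule tr_zero_span[OF linear_br_right assms(2)])
  fix f e assume fe: "f \<in> Bn" "e \<in> Bn"
  obtain c where "br A e = c *\<^sub>R e" using a_diag[OF assms(1) fe(2)] by blast
  moreover have "g (br f e) e = 0"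
    using weight_ortho[OF br_weight[OF fe(1) A0_weight] A0_weight, OF fe(2) fe(2)] weight_pos[OF fe(1)]
    by simp
  ultimately show "g (br A (br f e)) e = 0" using a_sym[OF assms(1)] by simp
qed

section \<open>The Ricci tensor of an Iwasawa splitting\<close>

lemma tr_h_ad_ad: "x \<in> h \<Longrightarrow> y \<in> h \<Longrightarrow> tr (Ba \<union> Bn) (\<lambda>z. br x (br y z)) = tr Bn (\<lambda>z. br x (br y z))"
  by (rule tr_h_eq_tr_n) (meson br_h_n n_sub_h)

context
  fixes H
  assumes H_a: "H \<in> span Ba" and H_tr: "\<And>A. A \<in> span Ba \<Longrightarrow> g H A = tr Bn (br A)"
begin

text \<open>On \<open>span Ba\<close> this is the assumption on \<open>H\<close>, and on
  \<open>span Bn\<close> both sides vanish. So a vector found from \<open>span Ba\<close> alone is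
  the mean curvature vector of \<open>h\<close>.\<close>

lemma g_H:
  assumes "x \<in> h"
  shows "g H x = tr (Ba \<union> Bn) (br x)"
proof -
  obtain A X where x: "A \<in> span Ba" "X \<in> span Bn" "x = A + X" using assms by (rule h_cases)
  have "tr (Ba \<union> Bn) (br x) = tr Bn (br x)" by (rule tr_h_eq_tr_n) (rule br_h_n[OF assms])
  also have "\<dots> = tr Bn (br A) + tr Bn (br X)"
    unfolding x(3) tr_def by (simp add: sum.distrib algebra_simps)
  finally show ?thesis using x H_tr tr_n_ad a_ortho_n[OF H_a] by simp
qed

lemma mean_curvature_eq: "mean_curvature h br g = H"
proof -
  have "trace_on h (br X) = tr (Ba \<union> Bn) (br X)" if "X \<in> h" for X
    by (rule trace_on_eq_tr_linear[OF onb_h linear_br_right]) (use that br_h_n n_sub_h in blast)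
  then show ?thesis
    unfolding mean_curvature_def using g_H a_sub_h[OF H_a] by (intro onb_the_eq[OF onb_h]) auto
qed

lemma ric_h: "x \<in> h \<Longrightarrow> y \<in> h \<Longrightarrow>
   ric h br g x y = ricci_nil (Ba \<union> Bn) x y - tr (Ba \<union> Bn) (\<lambda>z. br x (br y z)) / 2
     - (g (br H x) y + g (br H y) x) / 2"
  by (rule ric_formula[OF onb_h subalgebra_h _ _ a_sub_h[OF H_a] g_H])

lemma ric_h_commute:
  assumes "x \<in> h" "y \<in> h"
  shows "ric h br g x y = ric h br g y x"
proof -
  have "tr (Ba \<union> Bn) (\<lambda>z. br x (br y z)) = tr (Ba \<union> Bn) (\<lambda>z. br y (br x z))"
    by (rule tr_commute[OF onb_h linear_br_right linear_br_right])
      (use assms br_h_n n_sub_h in blast)+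
  then show ?thesis using ric_h assms ricci_nil_commute[of "Ba \<union> Bn" x y] by simp
qed

text \<open>Brackets are orthogonal to \<open>A\<close>, which removes the first sum of
  \<open>ricci_nil\<close>. Symmetry of \<open>ad A\<close> makes the second sum equal to the
  Killing term, so the two halves add up; the \<open>H\<close> terms vanish.\<close>

lemma ric_h_a:
  assumes A: "A \<in> span Ba" and y: "y \<in> h"
  shows "ric h br g A y = - tr Bn (\<lambda>z. br A (br y z))"
proof -
  have 0: "g (br x z) A = 0" if "x \<in> h" "z \<in> h" for x z
    using a_ortho_n[OF A br_h_n[OF that]] g_commute by metis
  have "ricci_nil (Ba \<union> Bn) A y = - tr (Ba \<union> Bn) (\<lambda>z. br A (br y z)) / 2"
  proof -
    have "g (br A e) (br y e) = g (br A (br y e)) e" for e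
      using a_sym[OF A, of e "br y e"] g_commute by metis
    then show ?thesis unfolding ricci_nil_def tr_def using 0 onb_in[OF onb_h] by simp
  qed
  moreover have "br H A = 0" by (rule a_abelian[OF H_a A])
  ultimately show ?thesis
    using ric_h[OF a_sub_h[OF A] y] 0[OF a_sub_h[OF H_a] y] tr_h_ad_ad[OF a_sub_h[OF A] y] by simp
qed

text \<open>Terms with one index in \<open>Ba\<close> and one in \<open>Bn\<close> occur twice in
  the first sum and cancel exactly the \<open>Ba\<close> part of the second.\<close>

lemma ricci_nil_h:
  assumes X: "X \<in> span Bn" and Y: "Y \<in> span Bn"
  shows "ricci_nil (Ba \<union> Bn) X Y = ricci_nil Bn X Y"
proof -
  let ?t = "\<lambda>e f. g e e * g f f * g (br e f) X * g (br e f) Y"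
  let ?s = "\<lambda>e. g e e * g (br X e) (br Y e)"
  have un: "(\<Sum>e\<in>Ba \<union> Bn. u e) = (\<Sum>e\<in>Ba. u e) + (\<Sum>e\<in>Bn. u e)" for u :: "'v \<Rightarrow> real"
    using fin disj by (simp add: sum.union_disjoint)
  have aa: "(\<Sum>e\<in>Ba. \<Sum>f\<in>Ba. ?t e f) = 0"
    by (intro sum.neutral ballI) (simp add: a_abelian span_base)
  \<comment> \<open>Symmetry moves \<open>ad e\<close> onto \<open>X\<close> and \<open>Y\<close>;
    the sum over \<open>f\<close> is then the expansion of
    \<open>g (br e X) (br e Y)\<close>.\<close>
  have an: "(\<Sum>f\<in>Bn. ?t e f) = ?s e" if "e \<in> Ba" for e
  proof -
    have e: "e \<in> span Ba" using that by (rule span_base)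
    have "(\<Sum>f\<in>Bn. ?t e f) = g e e * (\<Sum>f\<in>Bn. g f f * g (br e X) f * g f (br e Y))"
      unfolding sum_distrib_left
      by (intro sum.cong refl)
        (simp add: a_sym[OF e] g_commute[of _ "br e X"] mult_ac)
    also have "\<dots> = g e e * g (br e X) (br e Y)"
      using onb_expand_g[OF onb_n a_n[OF e X]] by simp
    finally show ?thesis using br_antisym[of e X] br_antisym[of e Y] by simp
  qed
  have "(\<Sum>e\<in>Bn. \<Sum>f\<in>Ba. ?t e f) = (\<Sum>f\<in>Ba. \<Sum>e\<in>Bn. ?t e f)" by (rule sum.swap)
  also have "\<dots> = (\<Sum>f\<in>Ba. \<Sum>e\<in>Bn. ?t f e)"
  proof (intro sum.cong refl)
    show "?t e f = ?t f e" for e f using br_antisym[of e f] by simp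
  qed
  finally have na: "(\<Sum>e\<in>Bn. \<Sum>f\<in>Ba. ?t e f) = (\<Sum>e\<in>Ba. ?s e)" using an by simp
  show ?thesis unfolding ricci_nil_def
    by (simp add: un sum.distrib aa an na add_divide_distrib)
qed

lemma ric_h_n:
  assumes X: "X \<in> span Bn" and Y: "Y \<in> span Bn"
  shows "ric h br g X Y = ricci_nil Bn X Y - g (br H X) Y"
  using ric_h[OF n_sub_h[OF X] n_sub_h[OF Y]] ricci_nil_h[OF X Y]
    tr_h_ad_ad[OF n_sub_h[OF X] n_sub_h[OF Y]] tr_n_ad_ad[OF X Y]
    a_sym[OF H_a, of X Y] g_commute[of X "br H Y"] by simp

end

text \<open>Positive weights make every \<open>ad Z\<close> on \<open>span Bn\<close> traceless, so
  the general formula applies with \<open>H = 0\<close>; the Killing term vanishes too.\<close>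

lemma ric_n:
  assumes X: "X \<in> span Bn" and Y: "Y \<in> span Bn"
  shows "ric (span Bn) br g X Y = ricci_nil Bn X Y"
proof -
  have "g 0 Z = tr Bn (br Z)" if "Z \<in> span Bn" for Z using tr_n_ad[OF that] by simp
  from ric_formula[OF onb_n subalgebra_n X Y span_zero this] show ?thesis
    using tr_n_ad_ad[OF X Y] by simp
qed

section \<open>Ricci endomorphisms of an Iwasawa splitting\<close>

lemma Ric_n_ex: "\<exists>V\<in>span Bn. \<forall>Y\<in>span Bn. g V Y = ricci_nil Bn X Y"
  by (rule onb_riesz[OF onb_n linear_ricci_nil])

lemma Ric_n_eqI:
  assumes "X \<in> span Bn" "V \<in> span Bn" "\<And>Y. Y \<in> span Bn \<Longrightarrow> g V Y = ricci_nil Bn X Y"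
  shows "Ric (span Bn) br g X = V"
  unfolding Ric_def using assms ric_n by (intro onb_the_eq[OF onb_n]) auto

lemma Ric_n:
  assumes "X \<in> span Bn"
  shows "Ric (span Bn) br g X \<in> span Bn"
    and "Y \<in> span Bn \<Longrightarrow> g (Ric (span Bn) br g X) Y = ricci_nil Bn X Y"
  using Ric_n_ex[of X] Ric_n_eqI[OF assms] by metis+

lemma ex_mean_curvature: "\<exists>H\<in>span Ba. \<forall>A\<in>span Ba. g H A = tr Bn (br A)"
proof -
  have "linear (\<lambda>A. tr Bn (br A))"
    by (rule linearI) (simp_all add: tr_def sum.distrib sum_distrib_left algebra_simps)
  then show ?thesis by (rule onb_riesz[OF onb_a])
qed

lemma ric_h_add:
  assumes "x \<in> h" "y \<in> h" "z \<in> h"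
  shows "ric h br g x (y + z) = ric h br g x y + ric h br g x z"
    and "ric h br g (y + z) x = ric h br g y x + ric h br g z x"
proof -
  obtain H where H: "H \<in> span Ba" "\<And>A. A \<in> span Ba \<Longrightarrow> g H A = tr Bn (br A)"
    using ex_mean_curvature by blast
  have yz: "y + z \<in> h" using assms onb_subspace[OF onb_h] by (simp add: subspace_add)
  show 1: "ric h br g x (y + z) = ric h br g x y + ric h br g x z"
    using ric_h[OF H assms(1)] assms yz
    by (simp add: linear_add[OF linear_ricci_nil] tr_add add_divide_distrib)
  show "ric h br g (y + z) x = ric h br g y x + ric h br g z x"
    using 1 ric_h_commute[OF H] assms yz by metis
qed

lemma Ric_h_ex:
  assumes "x \<in> h"
  shows "\<exists>V\<in>h. \<forall>y\<in>h. g V y = ric h br g x y"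
proof -
  obtain H where H: "H \<in> span Ba" "\<And>A. A \<in> span Ba \<Longrightarrow> g H A = tr Bn (br A)"
    using ex_mean_curvature by blast
  have "linear (\<lambda>y. ricci_nil (Ba \<union> Bn) x y - tr (Ba \<union> Bn) (\<lambda>z. br x (br y z)) / 2
      - (g (br H x) y + g (br H y) x) / 2)"
    by (rule linearI)
      (simp_all add: linear_add[OF linear_ricci_nil] linear_scale[OF linear_ricci_nil] tr_add
        tr_scale add_divide_distrib algebra_simps)
  from onb_riesz[OF onb_h this] show ?thesis using ric_h[OF H assms] by simp
qed

lemma Ric_h_eqI:
  assumes "V \<in> h" "\<And>y. y \<in> h \<Longrightarrow> g V y = ric h br g x y"
  shows "Ric h br g x = V"
  unfolding Ric_def using assms by (intro onb_the_eq[OF onb_h]) auto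

lemma Ric_h_add:
  assumes "x \<in> h" "y \<in> h"
  shows "Ric h br g (x + y) = Ric h br g x + Ric h br g y"
proof -
  obtain U where U: "U \<in> h" "\<And>z. z \<in> h \<Longrightarrow> g U z = ric h br g x z"
    using Ric_h_ex[OF assms(1)] by blast
  obtain V where V: "V \<in> h" "\<And>z. z \<in> h \<Longrightarrow> g V z = ric h br g y z"
    using Ric_h_ex[OF assms(2)] by blast
  have "Ric h br g (x + y) = U + V"
    using U V onb_subspace[OF onb_h] ric_h_add(2)[OF _ assms]
    by (intro Ric_h_eqI) (simp_all add: subspace_add)
  then show ?thesis using Ric_h_eqI[OF U] Ric_h_eqI[OF V] by simp
qed

text \<open>Both sides are tested against \<open>C + Y\<close>. Against \<open>C\<close> the Ricci
  tensor vanishes by its symmetry and \<open>tr_a_ad_ad\<close>, and the right side because it lies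
  in \<open>span Bn\<close>.\<close>

lemma Ric_h_n:
  assumes X: "X \<in> span Bn"
  shows "Ric h br g X = Ric (span Bn) br g X - br (mean_curvature h br g) X"
proof -
  obtain H where H: "H \<in> span Ba" "\<And>A. A \<in> span Ba \<Longrightarrow> g H A = tr Bn (br A)"
    using ex_mean_curvature by blast
  let ?V = "Ric (span Bn) br g X - br H X"
  have V: "?V \<in> span Bn" using Ric_n(1)[OF X] a_n[OF H(1) X] by (rule span_diff)
  have "g ?V y = ric h br g X y" if y: "y \<in> h" for y
  proof -
    obtain C Y where CY: "C \<in> span Ba" "Y \<in> span Bn" "y = C + Y" using y by (rule h_cases)
    have lin: "ric h br g X y = ric h br g X C + ric h br g X Y"
      unfolding CY(3) by (rule ric_h_add(1)[OF n_sub_h[OF X] a_sub_h[OF CY(1)] n_sub_h[OF CY(2)]])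
    have "ric h br g X C = 0"
      using ric_h_commute[OF H n_sub_h[OF X] a_sub_h[OF CY(1)]] ric_h_a[OF H CY(1) n_sub_h[OF X]]
        tr_a_ad_ad[OF CY(1) X] by simp
    moreover have "g ?V C = 0" using a_ortho_n[OF CY(1) V] g_commute by metis
    moreover have "g ?V Y = ric h br g X Y"
      using ric_h_n[OF H X CY(2)] Ric_n(2)[OF X CY(2)] by simp
    ultimately show ?thesis using lin unfolding CY(3) by (simp only: g_add)
  qed
  then have "Ric h br g X = ?V"
    using n_sub_h[OF V] by (intro Ric_h_eqI) auto
  moreover have "mean_curvature h br g = H" by (rule mean_curvature_eq[OF H])
  ultimately show ?thesis by simp
qed

text \<open>Testing \<open>V\<close> against \<open>span Ba\<close> is enough: against
  \<open>span Bn\<close> both the product and the Ricci tensor vanish.\<close>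

lemma Ric_h_a:
  assumes A: "A \<in> span Ba" and V: "V \<in> span Ba"
    and g_V: "\<And>C. C \<in> span Ba \<Longrightarrow> g V C = - tr Bn (\<lambda>z. br A (br C z))"
  shows "Ric h br g A = V"
proof -
  obtain H where H: "H \<in> span Ba" "\<And>A. A \<in> span Ba \<Longrightarrow> g H A = tr Bn (br A)"
    using ex_mean_curvature by blast
  have "g V y = ric h br g A y" if y: "y \<in> h" for y
  proof -
    obtain C Y where CY: "C \<in> span Ba" "Y \<in> span Bn" "y = C + Y" using y by (rule h_cases)
    have "tr Bn (\<lambda>z. br A (br y z)) = tr Bn (\<lambda>z. br A (br C z)) + tr Bn (\<lambda>z. br A (br Y z))"
      unfolding CY(3) by (simp add: tr_add)
    then show ?thesis
      using ric_h_a[OF H A y] g_V[OF CY(1)] tr_a_ad_ad[OF A CY(2)] a_ortho_n[OF V CY(2)]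
      unfolding CY(3) by simp
  qed
  then show ?thesis using a_sub_h[OF V] by (intro Ric_h_eqI) auto
qed

end

section \<open>Roots and attached subalgebras\<close>

locale iwasawa =
  fixes g :: "'v::real_vector \<Rightarrow> 'v \<Rightarrow> real" and br :: "'v \<Rightarrow> 'v \<Rightarrow> 'v"
  assumes strong_iwasawa: "strong_iwasawa br g"
begin

sublocale metric_lie g br
proof -
  have "metric_lie_algebra br g" using strong_iwasawa unfolding strong_iwasawa_def by simp
  then show "metric_lie g br" unfolding metric_lie_algebra_def by unfold_locales auto
qed

lemma finite_dim: "\<exists>S::'v set. finite S \<and> span S = UNIV"
  and a_commute: "A \<in> aa br g \<Longrightarrow> C \<in> aa br g \<Longrightarrow> br A C = 0"
  and a_pos: "A \<in> aa br g \<Longrightarrow> A \<noteq> 0 \<Longrightarrow> g A A > 0"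
  and a_n_decomposition: "{A + X | A X. A \<in> aa br g \<and> X \<in> nn br} = UNIV"
  and positive_element:
    "\<exists>A\<in>aa br g. \<forall>c. eigenvalue_on (nn br) (br A) c \<longrightarrow> Im c = 0 \<and> Re c > 0"
  using strong_iwasawa unfolding strong_iwasawa_def metric_lie_algebra_def by simp_all

lemma ad_a_sym: "A \<in> aa br g \<Longrightarrow> g (br A x) y = g x (br A y)"
  using strong_iwasawa unfolding strong_iwasawa_def by simp

lemma subspace_n: "subspace (nn br)"
  unfolding nn_def bracket_space_def by simp

lemma br_in_n: "br x y \<in> nn br"
  unfolding nn_def bracket_space_def by (auto intro: span_base)

lemma subspace_a: "subspace (aa br g)"
  unfolding aa_def by (rule subspaceI) auto

lemma a_n_ortho: "A \<in> aa br g \<Longrightarrow> X \<in> nn br \<Longrightarrow> g A X = 0"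
  unfolding aa_def by blast

lemma a_n_cases:
  obtains A X where "A \<in> aa br g" "X \<in> nn br" "x = A + X"
proof -
  have "x \<in> {A + X | A X. A \<in> aa br g \<and> X \<in> nn br}" by (simp only: a_n_decomposition UNIV_I)
  then show ?thesis using that by blast
qed

lemma ex_onb_a:
  assumes "subspace h" "h \<subseteq> aa br g"
  shows "\<exists>B. onb h B"
proof -
  obtain S :: "'v set" where S: "finite S" "span S = UNIV" using finite_dim by blast
  show ?thesis
  proof (rule ex_onb[OF assms(1) S(1)])
    show "x = 0" if "x \<in> h" "\<And>y. y \<in> h \<Longrightarrow> g x y = 0" for x
      using that a_pos[of x] assms by fastforce
  qed (use S in simp)
qed

section \<open>Functionals on \<open>\<a>\<close> and their representing vectors\<close>

lemma adual_linear: "\<alpha> \<in> adual br \<Longrightarrow> linear \<alpha>"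
  and adual_n: "\<alpha> \<in> adual br \<Longrightarrow> X \<in> nn br \<Longrightarrow> \<alpha> X = 0"
  unfolding adual_def by auto

lemma g_adual: "A \<in> aa br g \<Longrightarrow> g A \<in> adual br"
  unfolding adual_def using linear_g_right a_n_ortho by auto

lemma adual_eqI:
  assumes "\<alpha> \<in> adual br" "\<beta> \<in> adual br" "\<And>A. A \<in> aa br g \<Longrightarrow> \<alpha> A = \<beta> A"
  shows "\<alpha> = \<beta>"
proof
  fix x
  obtain A X where "A \<in> aa br g" "X \<in> nn br" "x = A + X" by (rule a_n_cases)
  then show "\<alpha> x = \<beta> x"
    using assms by (simp add: linear_add[OF adual_linear] adual_n)
qed

text \<open>\<open>sharp\<close> is specified by products with \<open>\<a>\<close> only;
  \<open>g_sharp\<close> holds for all \<open>x\<close> since both sides vanish on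
  \<open>\<n>\<close>.\<close>

lemma sharp:
  assumes "\<alpha> \<in> adual br"
  shows sharp_a: "sharp br g \<alpha> \<in> aa br g" and g_sharp: "g (sharp br g \<alpha>) x = \<alpha> x"
proof -
  obtain B where B: "onb (aa br g) B" using ex_onb_a[OF subspace_a order_refl] by blast
  obtain C where C: "C \<in> aa br g" "\<forall>A\<in>aa br g. g C A = \<alpha> A"
    using onb_riesz[OF B adual_linear[OF assms]] by blast
  have sharp: "sharp br g \<alpha> = C"
    unfolding sharp_def using C by (intro onb_the_eq[OF B]) auto
  show "sharp br g \<alpha> \<in> aa br g" using sharp C by simp
  have "g C = \<alpha>" by (rule adual_eqI[OF g_adual[OF C(1)] assms]) (use C in blast)
  then show "g (sharp br g \<alpha>) x = \<alpha> x" using sharp by simp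
qed

section \<open>Root spaces\<close>

lemma subspace_root_space: "subspace (root_space br g \<alpha>)"
  unfolding root_space_def using subspace_n
  by (auto intro!: subspaceI simp: subspace_0 subspace_add subspace_scale algebra_simps)

lemma root_space_n: "X \<in> root_space br g \<alpha> \<Longrightarrow> X \<in> nn br"
  and root_space_br: "X \<in> root_space br g \<alpha> \<Longrightarrow> A \<in> aa br g \<Longrightarrow> br A X = \<alpha> A *\<^sub>R X"
  unfolding root_space_def by auto

text \<open>The sum may fail to be a root: \<open>root_space\<close> accepts any function, so a
  bracket has a weight even when it vanishes.\<close>

lemma br_root_space:
  assumes "X \<in> root_space br g \<alpha>" "Y \<in> root_space br g \<beta>"
  shows "br X Y \<in> root_space br g (\<lambda>x. \<alpha> x + \<beta> x)"
  unfolding root_space_def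
proof (intro CollectI conjI ballI br_in_n)
  fix A assume A: "A \<in> aa br g"
  show "br A (br X Y) = (\<alpha> A + \<beta> A) *\<^sub>R br X Y"
    using br_br[of A X Y] root_space_br[OF assms(1) A] root_space_br[OF assms(2) A]
    by (simp add: algebra_simps)
qed

text \<open>Stated with arbitrary functions and one separating \<open>A\<close>, so that it also
  covers brackets, whose weights are sums of roots.\<close>

lemma root_space_ortho:
  assumes "X \<in> root_space br g \<alpha>" "Y \<in> root_space br g \<beta>" "A \<in> aa br g" "\<alpha> A \<noteq> \<beta> A"
  shows "g X Y = 0"
proof -
  have "\<alpha> A * g X Y = \<beta> A * g X Y"
    using ad_a_sym[OF assms(3), of X Y] root_space_br assms by simp
  then show ?thesis using assms(4) by simp
qed

lemma roots_ortho:
  assumes "X \<in> root_space br g \<alpha>" "Y \<in> root_space br g \<beta>"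
    and "\<alpha> \<in> adual br" "\<beta> \<in> adual br" "\<alpha> \<noteq> \<beta>"
  shows "g X Y = 0"
  using adual_eqI[OF assms(3,4)] root_space_ortho[OF assms(1,2)] assms(5) by metis

lemma roots_adual: "\<alpha> \<in> roots br g \<Longrightarrow> \<alpha> \<in> adual br"
  unfolding roots_def by blast

lemma root_vector:
  assumes "\<alpha> \<in> roots br g"
  obtains X where "X \<in> root_space br g \<alpha>" "X \<noteq> 0"
  using assms subspace_0[OF subspace_root_space] unfolding roots_def by blast

text \<open>Each \<open>\<alpha> A0\<close> is an eigenvalue of \<open>ad A0\<close> on
  \<open>\<n>\<close>, with a root vector as real part and \<open>0\<close> as imaginary part of the
  eigenvector.\<close>

lemma ex_positive: "\<exists>A0\<in>aa br g. \<forall>\<alpha>\<in>roots br g. \<alpha> A0 > 0"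
proof -
  obtain A0 where A0: "A0 \<in> aa br g"
      "\<forall>c. eigenvalue_on (nn br) (br A0) c \<longrightarrow> Im c = 0 \<and> Re c > 0"
    using positive_element by blast
  have "\<alpha> A0 > 0" if \<alpha>: "\<alpha> \<in> roots br g" for \<alpha>
  proof -
    obtain X where X: "X \<in> root_space br g \<alpha>" "X \<noteq> 0" using root_vector[OF \<alpha>] .
    have "eigenvalue_on (nn br) (br A0) (complex_of_real (\<alpha> A0))"
      unfolding eigenvalue_on_def
      using root_space_n[OF X(1)] X(2) root_space_br[OF X(1) A0(1)] subspace_0[OF subspace_n]
      by (intro bexI[of _ X] bexI[of _ 0]) auto
    then show ?thesis using A0(2) by auto
  qed
  then show ?thesis using A0 by blast
qed

end

locale attached = iwasawa +
  fixes L L' :: "('a \<Rightarrow> real) set"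
  assumes root_decomposition: "root_decomposition br g"
    and attaching_data: "attaching_data br g L L'"
begin

section \<open>The dual basis of \<open>\<a>\<close> and the subspace \<open>\<a>'\<close>\<close>

lemma L'_sub: "L' \<subseteq> L" and L_roots: "L \<subseteq> roots br g" and finite_L: "finite L"
  using attaching_data unfolding attaching_data_def adual_basis_def by auto

lemma L_adual: "\<beta> \<in> L \<Longrightarrow> \<beta> \<in> adual br"
  using L_roots roots_adual by blast

lemma L_indep: "(\<And>x. (\<Sum>\<beta>\<in>L. c \<beta> * \<beta> x) = 0) \<Longrightarrow> \<beta> \<in> L \<Longrightarrow> c \<beta> = 0"
  using attaching_data unfolding attaching_data_def adual_basis_def by meson

text \<open>\<open>L\<close> spans the dual of \<open>\<a>\<close>, so \<open>g A\<close> is a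
  combination of functionals that kill \<open>A\<close>. Hence \<open>g A A = 0\<close>, and
  \<open>g\<close> is positive definite on \<open>\<a>\<close>.\<close>

lemma a_eq_0I:
  assumes "A \<in> aa br g" "\<And>\<beta>. \<beta> \<in> L \<Longrightarrow> \<beta> A = 0"
  shows "A = 0"
proof -
  obtain c where c: "\<forall>x. g A x = (\<Sum>\<beta>\<in>L. c \<beta> * \<beta> x)"
    using attaching_data g_adual[OF assms(1)]
    unfolding attaching_data_def adual_basis_def by meson
  have "(\<Sum>\<beta>\<in>L. c \<beta> * \<beta> A) = 0"
    by (intro sum.neutral ballI) (metis assms(2) mult_zero_right)
  then have "g A A = 0" using c by metis
  then show ?thesis using a_pos[OF assms(1)] by fastforce
qed

text \<open>Independence of \<open>L\<close> is carried over to the vectors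
  \<open>sharp br g \<alpha>\<close>, on which a linear \<open>k\<close> may be prescribed; the
  vector of \<open>\<a>\<close> representing \<open>k\<close> is the dual vector.\<close>

lemma ex_dual_vec:
  assumes \<beta>: "\<beta> \<in> L"
  shows "\<exists>C\<in>aa br g. \<forall>\<alpha>\<in>L. \<alpha> C = (if \<alpha> = \<beta> then 1 else 0)"
proof -
  have inj: "inj_on (sharp br g) L"
  proof (rule inj_onI)
    fix \<alpha> \<gamma> assume "\<alpha> \<in> L" "\<gamma> \<in> L" "sharp br g \<alpha> = sharp br g \<gamma>"
    then show "\<alpha> = \<gamma>" using g_sharp[OF L_adual] by (metis ext)
  qed
  have "independent (sharp br g ` L)"
  proof -
    have "u (sharp br g \<alpha>) = 0" if 0: "(\<Sum>v\<in>sharp br g ` L. u v *\<^sub>R v) = 0" and "\<alpha> \<in> L" for u \<alpha>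
    proof (rule L_indep[of "\<lambda>\<alpha>. u (sharp br g \<alpha>)", OF _ \<open>\<alpha> \<in> L\<close>])
      fix x
      have "(\<Sum>\<alpha>\<in>L. u (sharp br g \<alpha>) * \<alpha> x) = g (\<Sum>\<alpha>\<in>L. u (sharp br g \<alpha>) *\<^sub>R sharp br g \<alpha>) x"
        by (simp add: g_sharp L_adual)
      also have "\<dots> = g (\<Sum>v\<in>sharp br g ` L. u v *\<^sub>R v) x"
        by (simp only: sum.reindex[OF inj] o_def)
      finally show "(\<Sum>\<alpha>\<in>L. u (sharp br g \<alpha>) * \<alpha> x) = 0" using 0 by simp
    qed
    note 0 = this
    show ?thesis
    proof
      assume "dependent (sharp br g ` L)"
      then obtain u v where uv: "v \<in> sharp br g ` L" "u v \<noteq> 0"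
          "(\<Sum>v\<in>sharp br g ` L. u v *\<^sub>R v) = 0"
        unfolding dependent_finite[OF finite_imageI[OF finite_L]] by blast
      from uv(1) obtain \<alpha> where "\<alpha> \<in> L" "v = sharp br g \<alpha>" by (rule imageE)
      then show False using 0[OF uv(3)] uv(2) by metis
    qed
  qed
  from linear_independent_extend[OF this, of "\<lambda>x. if x = sharp br g \<beta> then 1 else 0 :: real"]
  obtain k where k: "linear k" "\<forall>x\<in>sharp br g ` L. k x = (if x = sharp br g \<beta> then 1 else 0 :: real)"
    by auto
  obtain B where B: "onb (aa br g) B" using ex_onb_a[OF subspace_a order_refl] by blast
  obtain C where C: "C \<in> aa br g" "\<forall>A\<in>aa br g. g C A = k A" using onb_riesz[OF B k(1)] by blast
  have "\<alpha> C = (if \<alpha> = \<beta> then 1 else 0)" if \<alpha>: "\<alpha> \<in> L" for \<alpha>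
  proof -
    have "\<alpha> C = k (sharp br g \<alpha>)"
      using C(2) sharp_a[OF L_adual[OF \<alpha>]] g_sharp[OF L_adual[OF \<alpha>], of C] g_commute by metis
    also have "\<dots> = (if \<alpha> = \<beta> then 1 else 0)"
      using k(2) \<alpha> inj_on_eq_iff[OF inj \<alpha> \<beta>] by simp
    finally show ?thesis .
  qed
  then show ?thesis using C(1) by blast
qed

lemma dual_vec:
  assumes "\<beta> \<in> L"
  shows "dual_vec br g L \<beta> \<in> aa br g"
    and "\<alpha> \<in> L \<Longrightarrow> \<alpha> (dual_vec br g L \<beta>) = (if \<alpha> = \<beta> then 1 else 0)"
proof -
  obtain C where C: "C \<in> aa br g" "\<forall>\<alpha>\<in>L. \<alpha> C = (if \<alpha> = \<beta> then 1 else 0)"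
    using ex_dual_vec[OF assms] by blast
  have "dual_vec br g L \<beta> = C" unfolding dual_vec_def
  proof (rule the_equality)
    fix D assume D: "D \<in> aa br g \<and> (\<forall>\<alpha>\<in>L. \<alpha> D = (if \<alpha> = \<beta> then 1 else 0))"
    have "D - C = 0"
    proof (rule a_eq_0I)
      show "D - C \<in> aa br g" using D C by (simp add: subspace_diff[OF subspace_a])
      show "\<alpha> (D - C) = 0" if "\<alpha> \<in> L" for \<alpha>
        using D C that linear_diff[OF adual_linear[OF L_adual[OF that]], of D C] by simp
    qed
    then show "D = C" by simp
  qed (use C in blast)
  then show "dual_vec br g L \<beta> \<in> aa br g"
    "\<alpha> \<in> L \<Longrightarrow> \<alpha> (dual_vec br g L \<beta>) = (if \<alpha> = \<beta> then 1 else 0)" using C by auto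
qed

lemma dual_vec_expand:
  assumes v: "v \<in> aa br g"
  shows "v = (\<Sum>\<beta>\<in>L. \<beta> v *\<^sub>R dual_vec br g L \<beta>)"
proof -
  have "v - (\<Sum>\<beta>\<in>L. \<beta> v *\<^sub>R dual_vec br g L \<beta>) = 0"
  proof (rule a_eq_0I)
    show "v - (\<Sum>\<beta>\<in>L. \<beta> v *\<^sub>R dual_vec br g L \<beta>) \<in> aa br g"
      using v dual_vec(1) subspace_a
      by (intro subspace_diff subspace_sum subspace_scale) auto
    fix \<alpha> assume \<alpha>: "\<alpha> \<in> L"
    note lin = adual_linear[OF L_adual[OF \<alpha>]]
    have "(\<Sum>\<beta>\<in>L. \<beta> v * \<alpha> (dual_vec br g L \<beta>)) = (\<Sum>\<beta>\<in>L. if \<alpha> = \<beta> then \<beta> v else 0)"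
      using dual_vec(2)[OF _ \<alpha>] by (intro sum.cong) auto
    then show "\<alpha> (v - (\<Sum>\<beta>\<in>L. \<beta> v *\<^sub>R dual_vec br g L \<beta>)) = 0"
      using \<alpha> finite_L by (simp add: linear_diff[OF lin] linear_sum[OF lin] linear_scale[OF lin])
  qed
  then show ?thesis by simp
qed

lemma att_a_sub: "att_a br g L L' \<subseteq> aa br g"
  unfolding att_a_def using dual_vec(1) subspace_a by (intro span_minimal) auto

text \<open>The coefficients of \<open>v\<close> in the dual basis are the values
  \<open>\<beta> v\<close>. With \<open>L'_att_a\<close> this makes \<open>\<a>'\<close> the common
  kernel of \<open>L'\<close> in \<open>\<a>\<close>.\<close>

lemma in_att_aI:
  assumes "v \<in> aa br g" "\<And>\<beta>. \<beta> \<in> L' \<Longrightarrow> \<beta> v = 0"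
  shows "v \<in> att_a br g L L'"
proof -
  have "(\<Sum>\<beta>\<in>L. \<beta> v *\<^sub>R dual_vec br g L \<beta>) \<in> att_a br g L L'"
    unfolding att_a_def
  proof (rule span_sum)
    show "\<beta> v *\<^sub>R dual_vec br g L \<beta> \<in> span (dual_vec br g L ` (L - L'))" if "\<beta> \<in> L" for \<beta>
      using assms(2)[of \<beta>] that
      by (cases "\<beta> \<in> L'") (auto intro: span_scale span_base simp: span_zero)
  qed
  then show ?thesis using dual_vec_expand[OF assms(1)] by simp
qed

lemma att_a_zero:
  assumes "\<alpha> \<in> adual br" "\<And>\<beta>. \<beta> \<in> L - L' \<Longrightarrow> \<alpha> (dual_vec br g L \<beta>) = 0" "A \<in> att_a br g L L'"
  shows "\<alpha> A = 0"
  using linear_eq_0_on_span[OF adual_linear[OF assms(1)], of "dual_vec br g L ` (L - L')" A] assms(2,3)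
  unfolding att_a_def by blast

lemma L'_att_a:
  assumes "\<beta> \<in> L'" "A \<in> att_a br g L L'"
  shows "\<beta> A = 0"
proof (rule att_a_zero[OF _ _ assms(2)])
  have \<beta>: "\<beta> \<in> L" using assms(1) L'_sub by blast
  then show "\<beta> \<in> adual br" by (rule L_adual)
  show "\<beta> (dual_vec br g L \<gamma>) = 0" if "\<gamma> \<in> L - L'" for \<gamma>
    using that dual_vec(2)[of \<gamma> \<beta>] \<beta> assms(1) by (cases "\<beta> = \<gamma>") auto
qed

section \<open>Signs of the roots on \<open>Z\<close>\<close>

abbreviation "Z \<equiv> zvec br g L L'"

lemma Z_a: "Z \<in> aa br g"
  unfolding zvec_def using dual_vec(1) by (intro subspace_sum[OF subspace_a]) auto

text \<open>The dual vectors read off the coefficients of a root in \<open>L\<close>, and these are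
  natural numbers.\<close>

lemma root_dual_vec:
  assumes "\<alpha> \<in> roots br g"
  shows "\<beta> \<in> L \<Longrightarrow> \<alpha> (dual_vec br g L \<beta>) \<ge> 0"
    and "\<alpha> Z = (\<Sum>\<beta>\<in>L - L'. \<alpha> (dual_vec br g L \<beta>))"
proof -
  obtain c :: "('a \<Rightarrow> real) \<Rightarrow> nat" where c: "\<forall>x. \<alpha> x = (\<Sum>\<gamma>\<in>L. real (c \<gamma>) * \<gamma> x)"
    using attaching_data assms unfolding attaching_data_def by meson
  show "\<alpha> (dual_vec br g L \<beta>) \<ge> 0" if "\<beta> \<in> L"
  proof -
    have "real (c \<gamma>) * \<gamma> (dual_vec br g L \<beta>) \<ge> 0" if "\<gamma> \<in> L" for \<gamma>
      using dual_vec(2)[OF \<open>\<beta> \<in> L\<close> that] by simp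
    then show ?thesis using c by (simp add: sum_nonneg)
  qed
  show "\<alpha> Z = (\<Sum>\<beta>\<in>L - L'. \<alpha> (dual_vec br g L \<beta>))"
    unfolding zvec_def by (rule linear_sum[OF adual_linear[OF roots_adual[OF assms]]])
qed

lemma roots_split: "roots br g = pos_roots br g L L' \<union> null_roots br g L L'"
proof -
  have "\<alpha> Z \<ge> 0" if "\<alpha> \<in> roots br g" for \<alpha>
    unfolding root_dual_vec(2)[OF that] using root_dual_vec(1)[OF that] by (intro sum_nonneg) auto
  then show ?thesis unfolding pos_roots_def null_roots_def by force
qed

text \<open>\<open>\<alpha> Z\<close> is a sum of nonnegative values, so if it is \<open>0\<close>,
  then \<open>\<alpha>\<close> vanishes on each of the dual vectors that span
  \<open>\<a>'\<close>.\<close>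

lemma null_root_att_a:
  assumes "\<alpha> \<in> null_roots br g L L'" "A \<in> att_a br g L L'"
  shows "\<alpha> A = 0"
proof (rule att_a_zero[OF _ _ assms(2)])
  have \<alpha>: "\<alpha> \<in> roots br g" "\<alpha> Z = 0" using assms unfolding null_roots_def by auto
  show "\<alpha> \<in> adual br" by (rule roots_adual[OF \<alpha>(1)])
  show "\<alpha> (dual_vec br g L \<beta>) = 0" if "\<beta> \<in> L - L'" for \<beta>
  proof -
    have "(\<Sum>\<beta>\<in>L - L'. \<alpha> (dual_vec br g L \<beta>)) = 0" using \<alpha>(2) root_dual_vec(2)[OF \<alpha>(1)] by simp
    moreover have "0 \<le> \<alpha> (dual_vec br g L \<beta>)" if "\<beta> \<in> L - L'" for \<beta>
      using root_dual_vec(1)[OF \<alpha>(1)] that by blast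
    ultimately show ?thesis
      using sum_nonneg_eq_0_iff[of "L - L'" "\<lambda>\<beta>. \<alpha> (dual_vec br g L \<beta>)"] finite_L that by blast
  qed
qed

text \<open>Root spaces are nondegenerate and mutually orthogonal, so orthonormal bases of them can
  be united and then split by the sign of \<open>\<alpha> Z\<close>. This supplies the witness for
  the existential in the Jacobi Star Condition.\<close>

lemma ex_compatible_onb: "\<exists>E' Ep. compatible_onb br g L L' E' Ep"
proof -
  obtain S :: "'a set" where S: "finite S" "span S = UNIV" using finite_dim by blast
  have "\<exists>B. onb (root_space br g \<alpha>) B" if "\<alpha> \<in> roots br g" for \<alpha>
  proof (rule ex_onb[OF subspace_root_space S(1)])
    show "x = 0" if "x \<in> root_space br g \<alpha>" "\<And>y. y \<in> root_space br g \<alpha> \<Longrightarrow> g x y = 0" for x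
      using root_decomposition that \<open>\<alpha> \<in> roots br g\<close> unfolding root_decomposition_def by simp
  qed (use S in simp)
  then obtain b where b: "\<And>\<alpha>. \<alpha> \<in> roots br g \<Longrightarrow> onb (root_space br g \<alpha>) (b \<alpha>)" by metis
  let ?E = "\<lambda>R. \<Union>\<alpha>\<in>R. b \<alpha>"
  have ortho: "orthonormal (?E (roots br g))"
    unfolding orthonormal_def
  proof (intro conjI ballI impI)
    fix e f assume "e \<in> ?E (roots br g)" "f \<in> ?E (roots br g)" "e \<noteq> f"
    then obtain \<alpha> \<beta> where ab: "\<alpha> \<in> roots br g" "\<beta> \<in> roots br g" "e \<in> b \<alpha>" "f \<in> b \<beta>" by blast
    show "g e f = 0"
    proof (cases "\<alpha> = \<beta>")
      case True
      then show ?thesis using b[OF ab(1)] ab \<open>e \<noteq> f\<close> unfolding onb_def orthonormal_def by blast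
    next
      case False
      then show ?thesis
        using roots_ortho[OF onb_in[OF b[OF ab(1)] ab(3)] onb_in[OF b[OF ab(2)] ab(4)]]
          roots_adual ab(1,2) by blast
    qed
  next
    fix e assume "e \<in> ?E (roots br g)"
    then obtain \<alpha> where "\<alpha> \<in> roots br g" "e \<in> b \<alpha>" by blast
    then show "g e e = 1 \<or> g e e = - 1" using b[of \<alpha>] unfolding onb_def orthonormal_def by blast
  qed
  have span: "span (?E R) = span (\<Union>\<alpha>\<in>R. root_space br g \<alpha>)" if "R \<subseteq> roots br g" for R
  proof (rule span_eq[THEN iffD2], intro conjI)
    show "?E R \<subseteq> span (\<Union>\<alpha>\<in>R. root_space br g \<alpha>)"
    proof
      fix e assume "e \<in> ?E R"
      then obtain \<alpha> where "\<alpha> \<in> R" "e \<in> b \<alpha>" by blast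
      then show "e \<in> span (\<Union>\<alpha>\<in>R. root_space br g \<alpha>)"
        using onb_in[OF b[of \<alpha>], of e] that by (intro span_base) blast
    qed
    have "root_space br g \<alpha> \<subseteq> span (?E R)" if "\<alpha> \<in> R" for \<alpha>
      using b[of \<alpha>] \<open>R \<subseteq> roots br g\<close> that span_mono[of "b \<alpha>" "?E R"] unfolding onb_def by blast
    then show "(\<Union>\<alpha>\<in>R. root_space br g \<alpha>) \<subseteq> span (?E R)" by blast
  qed
  let ?P = "pos_roots br g L L'" and ?N = "null_roots br g L L'"
  have un: "?E ?P \<union> ?E ?N = ?E (roots br g)" unfolding roots_split by blast
  have ind: "independent (?E (roots br g))" by (rule orthonormal_independent[OF ortho])
  have sub: "?P \<subseteq> roots br g" "?N \<subseteq> roots br g" using roots_split by auto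
  have "compatible_onb br g L L' (?E ?P) (?E ?N)"
    unfolding compatible_onb_def un att_n_def att_n0_def
  proof (intro conjI span sub ind)
    show "independent (?E ?P)" "independent (?E ?N)"
      using independent_mono[OF ind] un by blast+
    show "span (?E (roots br g)) = nn br"
      using span[OF order_refl] root_decomposition unfolding root_decomposition_def by simp
    show "\<forall>e\<in>?E (roots br g). \<forall>f\<in>?E (roots br g). e \<noteq> f \<longrightarrow> g e f = 0"
      "\<forall>e\<in>?E (roots br g). g e e \<in> {- 1, 1}"
      using ortho unfolding orthonormal_def by blast+
    show "\<forall>e\<in>?E (roots br g). \<exists>\<alpha>\<in>roots br g. e \<in> root_space br g \<alpha>"
    proof
      fix e assume "e \<in> ?E (roots br g)"
      then obtain \<alpha> where "\<alpha> \<in> roots br g" "e \<in> b \<alpha>" by blast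
      then show "\<exists>\<alpha>\<in>roots br g. e \<in> root_space br g \<alpha>" using onb_in[OF b] by blast
    qed
  qed
  then show ?thesis by blast
qed

end

section \<open>Compatible bases and the Jacobi Star Condition\<close>

text \<open>\<open>Ba\<close>, \<open>Ba'\<close> and \<open>A0\<close> are auxiliary choices, which always exist (\<open>ex_compatible\<close> below).\<close>

locale compatible = attached +
  fixes E' Ep Ba Ba' :: "'a set" and A0 :: 'a
  assumes compatible: "compatible_onb br g L L' E' Ep"
    and Ba: "onb (aa br g) Ba" and Ba': "onb (att_a br g L L') Ba'"
    and A0: "A0 \<in> aa br g" "\<And>\<alpha>. \<alpha> \<in> roots br g \<Longrightarrow> \<alpha> A0 > 0"
begin

text \<open>A basis vector is nonzero and so belongs to the root space of only one root; the choice
  is unambiguous.\<close>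

definition rt :: "'a \<Rightarrow> 'a \<Rightarrow> real" where
  "rt e = (SOME \<alpha>. \<alpha> \<in> roots br g \<and> e \<in> root_space br g \<alpha>)"

lemma orthonormal_B: "orthonormal (E' \<union> Ep)"
  using compatible unfolding compatible_onb_def orthonormal_def by auto

lemma finite_B: "finite (E' \<union> Ep)"
proof -
  obtain S :: "'a set" where S: "finite S" "span S = UNIV" using finite_dim by blast
  show ?thesis by (rule orthonormal_finite(1)[OF S(1) _ orthonormal_B]) (use S in simp)
qed

lemma onb_B: "onb (nn br) (E' \<union> Ep)"
  and onb_E': "onb (att_n br g L L') E'"
  and onb_Ep: "onb (att_n0 br g L L') Ep"
  using compatible finite_B orthonormal_B
  unfolding compatible_onb_def onb_def orthonormal_def by auto

lemma span_B: "span (E' \<union> Ep) = nn br" and span_E': "span E' = att_n br g L L'"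
  using onb_B onb_E' unfolding onb_def by auto

lemma unit_nonzero: "e \<in> E' \<union> Ep \<Longrightarrow> g e e \<noteq> 0"
  using orthonormal_square[OF orthonormal_B, of e] by force

lemma rt:
  assumes "e \<in> E' \<union> Ep"
  shows rt_root: "rt e \<in> roots br g" and rt_space: "e \<in> root_space br g (rt e)"
proof -
  have "\<forall>e\<in>E' \<union> Ep. \<exists>\<alpha>\<in>roots br g. e \<in> root_space br g \<alpha>"
    using compatible unfolding compatible_onb_def by (elim conjE) assumption
  then have "\<exists>\<alpha>. \<alpha> \<in> roots br g \<and> e \<in> root_space br g \<alpha>" using assms by blast
  from someI_ex[OF this] show "rt e \<in> roots br g" "e \<in> root_space br g (rt e)"
    unfolding rt_def by auto
qed

lemma rt_adual: "e \<in> E' \<union> Ep \<Longrightarrow> rt e \<in> adual br"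
  by (rule roots_adual[OF rt_root])

lemma rt_br: "e \<in> E' \<union> Ep \<Longrightarrow> A \<in> aa br g \<Longrightarrow> br A e = rt e A *\<^sub>R e"
  by (rule root_space_br[OF rt_space])

lemma att_n_ortho_n0: "X \<in> att_n br g L L' \<Longrightarrow> Y \<in> att_n0 br g L L' \<Longrightarrow> g X Y = 0"
  unfolding att_n_def att_n0_def
proof (erule (1) span_ortho)
  fix a e assume "a \<in> (\<Union>\<alpha>\<in>pos_roots br g L L'. root_space br g \<alpha>)"
    "e \<in> (\<Union>\<alpha>\<in>null_roots br g L L'. root_space br g \<alpha>)"
  then obtain \<alpha> \<beta> where "\<alpha> \<in> pos_roots br g L L'" "a \<in> root_space br g \<alpha>"
    "\<beta> \<in> null_roots br g L L'" "e \<in> root_space br g \<beta>" by blast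
  then show "g a e = 0"
    using root_space_ortho[OF _ _ Z_a] unfolding pos_roots_def null_roots_def by fastforce
qed

lemma root_space_att:
  "\<alpha> \<in> pos_roots br g L L' \<Longrightarrow> e \<in> root_space br g \<alpha> \<Longrightarrow> e \<in> att_n br g L L'"
  "\<alpha> \<in> null_roots br g L L' \<Longrightarrow> e \<in> root_space br g \<alpha> \<Longrightarrow> e \<in> att_n0 br g L L'"
  unfolding att_n_def att_n0_def by (auto intro!: span_base)

text \<open>A vector of \<open>E'\<close> with a null root would lie in both \<open>att_n\<close>
  and \<open>att_n0\<close> and be orthogonal to itself; the same holds for a vector of
  \<open>Ep\<close> with a positive root.\<close>

lemma rt_pos: "e \<in> E' \<Longrightarrow> rt e \<in> pos_roots br g L L'"
  and rt_null: "e \<in> Ep \<Longrightarrow> rt e \<in> null_roots br g L L'"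
proof -
  have B: "rt e \<in> pos_roots br g L L' \<or> rt e \<in> null_roots br g L L'" "e \<in> root_space br g (rt e)"
    "g e e \<noteq> 0" if "e \<in> E' \<union> Ep" for e
    using rt[OF that] roots_split unit_nonzero[OF that] by auto
  show "rt e \<in> pos_roots br g L L'" if "e \<in> E'"
    using B[of e] root_space_att(2)[of "rt e" e] att_n_ortho_n0[OF onb_in[OF onb_E' that], of e] that
    by blast
  show "rt e \<in> null_roots br g L L'" if "e \<in> Ep"
    using B[of e] root_space_att(1)[of "rt e" e] att_n_ortho_n0[OF _ onb_in[OF onb_Ep that], of e] that
    by blast
qed

section \<open>The grading of \<open>\<n>\<close> by \<open>Z\<close>\<close>

lemma Z_weight:
  shows "e \<in> E' \<Longrightarrow> rt e Z > 0" and "e \<in> Ep \<Longrightarrow> rt e Z = 0"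
  using rt_pos rt_null unfolding pos_roots_def null_roots_def by auto

lemma disjoint_E: "E' \<inter> Ep = {}"
  using Z_weight by force

lemma sum_B: "(\<Sum>e\<in>E' \<union> Ep. f e) = (\<Sum>e\<in>E'. f e) + (\<Sum>e\<in>Ep. f e)"
  using finite_B disjoint_E by (simp add: sum.union_disjoint)

lemma in_att_nI:
  assumes "x \<in> nn br" "\<And>y. y \<in> Ep \<Longrightarrow> g x y = 0"
  shows "x \<in> att_n br g L L'"
proof -
  have "x = (\<Sum>e\<in>E'. (g e e * g x e) *\<^sub>R e)"
    using onb_expand[OF onb_B assms(1)] assms(2) unfolding sum_B by simp
  then show ?thesis using onb_sum_in[OF onb_E'] by metis
qed

lemma in_att_n0I:
  assumes "x \<in> nn br" "\<And>y. y \<in> E' \<Longrightarrow> g x y = 0"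
  shows "x \<in> att_n0 br g L L'"
proof -
  have "x = (\<Sum>e\<in>Ep. (g e e * g x e) *\<^sub>R e)"
    using onb_expand[OF onb_B assms(1)] assms(2) unfolding sum_B by simp
  then show ?thesis using onb_sum_in[OF onb_Ep] by metis
qed

lemma g_br_zero:
  assumes "e \<in> E' \<union> Ep" "f \<in> E' \<union> Ep" "k \<in> E' \<union> Ep" "rt e Z + rt f Z \<noteq> rt k Z"
  shows "g (br e f) k = 0"
  by (rule root_space_ortho[OF br_root_space[OF rt_space rt_space] rt_space Z_a])
    (use assms in auto)

text \<open>The \<open>Z\<close> weight of the bracket is positive, while vectors of
  \<open>Ep\<close> have weight \<open>0\<close>. So \<open>\<n>'\<close> is an ideal of
  \<open>\<n>\<close>.\<close>

lemma br_B_E': "e \<in> E' \<union> Ep \<Longrightarrow> f \<in> E' \<Longrightarrow> br e f \<in> att_n br g L L'"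
proof (rule in_att_nI[OF br_in_n])
  fix y assume e: "e \<in> E' \<union> Ep" and f: "f \<in> E'" and y: "y \<in> Ep"
  have "rt e Z \<ge> 0" using Z_weight e by fastforce
  then show "g (br e f) y = 0"
    using Z_weight(1)[OF f] Z_weight(2)[OF y] e f y by (intro g_br_zero) auto
qed

lemma br_Ep_Ep: "e \<in> Ep \<Longrightarrow> f \<in> Ep \<Longrightarrow> br e f \<in> att_n0 br g L L'"
proof (rule in_att_n0I[OF br_in_n])
  fix y assume "e \<in> Ep" "f \<in> Ep" "y \<in> E'"
  then show "g (br e f) y = 0"
    using Z_weight(2)[of e] Z_weight(2)[of f] Z_weight(1)[of y] by (intro g_br_zero) auto
qed

lemma br_B_att_n: "e \<in> E' \<union> Ep \<Longrightarrow> X \<in> att_n br g L L' \<Longrightarrow> br e X \<in> att_n br g L L'"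
  using br_span_closed[of e "{e}" X E' E'] br_B_E' span_E' by (auto simp: span_base)

text \<open>One verification serves both \<open>\<s>\<close> (all basis vectors) and
  \<open>\<s>'\<close> (only \<open>E'\<close>); the subspace of \<open>\<a>\<close> and the closure
  under brackets are the only differences.\<close>

lemma split_axioms:
  assumes C: "onb a C" "a \<subseteq> aa br g" and F: "F \<subseteq> E' \<union> Ep"
    and closed: "\<And>e f. e \<in> F \<Longrightarrow> f \<in> F \<Longrightarrow> br e f \<in> span F"
  shows "iwasawa_split g br C F A0 (\<lambda>e. rt e A0)"
proof -
  have spanC: "span C = a" and finC: "finite C" and onC: "orthonormal C"
    using C(1) unfolding onb_def by auto
  have Ca: "A \<in> aa br g" if "A \<in> C" for A using onb_in[OF C(1) that] C(2) by blast
  have Fn: "e \<in> nn br" if "e \<in> F" for e using onb_in[OF onb_B] that F by blast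
  have CF: "g A e = 0" "g e A = 0" if "A \<in> C" "e \<in> F" for A e
    using a_n_ortho[OF Ca[OF that(1)] Fn[OF that(2)]] g_commute[of e A] by auto
  have onF: "orthonormal F" using orthonormal_B F unfolding orthonormal_def by blast
  show ?thesis
  proof unfold_locales
    show "finite C" "finite F" using finC finite_B F finite_subset by auto
    show "C \<inter> F = {}" using CF unit_nonzero F by blast
    show "orthonormal (C \<union> F)"
      using onC onF CF unfolding orthonormal_def by auto
    show "br A D = 0" if "A \<in> span C" "D \<in> span C" for A D
      using a_commute that C(2) unfolding spanC by blast
    show "\<exists>c. br A e = c *\<^sub>R e" if "A \<in> span C" "e \<in> F" for A e
      using rt_br[of e A] that C(2) F unfolding spanC by blast
    show "g (br A x) y = g x (br A y)" if "A \<in> span C" for A x y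
      using ad_a_sym that C(2) unfolding spanC by blast
    show "g (br A0 x) y = g x (br A0 y)" for x y by (rule ad_a_sym[OF A0(1)])
    show "br A0 e = rt e A0 *\<^sub>R e" if "e \<in> F" for e using rt_br[OF _ A0(1)] that F by blast
    show "rt e A0 > 0" if "e \<in> F" for e using A0(2) rt_root that F by blast
  qed (rule closed)
qed

sublocale S: iwasawa_split g br Ba "E' \<union> Ep" A0 "\<lambda>e. rt e A0"
  by (rule split_axioms[OF Ba]) (simp_all add: span_B br_in_n)

sublocale S': iwasawa_split g br Ba' E' A0 "\<lambda>e. rt e A0"
  by (rule split_axioms[OF Ba' att_a_sub]) (auto simp: span_E' intro: br_B_E')

lemma S_h: "S.h = UNIV"
proof -
  have "span Ba = aa br g" using Ba unfolding onb_def by simp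
  then show ?thesis unfolding S.h_def span_Un[of Ba] span_B using a_n_decomposition by simp
qed

lemma S'_h: "S'.h = att_s br g L L'"
proof -
  have "span Ba' = att_a br g L L'" using Ba' unfolding onb_def by simp
  then show ?thesis unfolding S'.h_def span_Un[of Ba'] span_E' att_s_def by simp
qed

lemma span_Ba: "span Ba = aa br g" and span_Ba': "span Ba' = att_a br g L L'"
  using Ba Ba' unfolding onb_def by auto

section \<open>Root multiplicities and reflection symmetry\<close>

lemma tr_ad:
  assumes "F \<subseteq> E' \<union> Ep" "A \<in> aa br g"
  shows "tr F (br A) = (\<Sum>e\<in>F. rt e A)"
    and "C \<in> aa br g \<Longrightarrow> tr F (\<lambda>x. br A (br C x)) = (\<Sum>e\<in>F. rt e A * rt e C)"
proof -
  have 1: "g e e * g e e = 1" "br D e = rt e D *\<^sub>R e" if "e \<in> F" "D \<in> aa br g" for e D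
    using orthonormal_square[OF orthonormal_B] rt_br that assms(1) by blast+
  show "tr F (br A) = (\<Sum>e\<in>F. rt e A)"
    unfolding tr_def
  proof (intro sum.cong refl)
    fix e assume "e \<in> F"
    then show "g e e * g (br A e) e = rt e A"
      using 1(1)[OF _ assms(2)] 1(2)[OF _ assms(2)] by (simp add: mult.left_commute)
  qed
  show "tr F (\<lambda>x. br A (br C x)) = (\<Sum>e\<in>F. rt e A * rt e C)" if C: "C \<in> aa br g"
    unfolding tr_def
  proof (intro sum.cong refl)
    fix e assume "e \<in> F"
    then show "g e e * g (br A (br C e)) e = rt e A * rt e C"
      using 1(1)[OF _ C] 1(2)[OF _ assms(2)] 1(2)[OF _ C]
      by (simp add: mult.left_commute mult.commute)
  qed
qed

text \<open>Different roots are orthogonal, and no vector of \<open>Ep\<close> has the root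
  \<open>\<alpha>\<close> because \<open>\<alpha> Z > 0\<close>. The multiplicities preserved by the
  reflections thus count vectors of \<open>E'\<close>.\<close>

lemma dim_root_space:
  assumes "\<alpha> \<in> pos_roots br g L L'"
  shows "dim (root_space br g \<alpha>) = card {e\<in>E'. rt e = \<alpha>}"
proof (rule real_vector.dim_eq_card)
  let ?F = "{e\<in>E'. rt e = \<alpha>}"
  have \<alpha>: "\<alpha> \<in> roots br g" "\<alpha> Z > 0" using assms unfolding pos_roots_def by auto
  show "independent ?F"
    by (rule independent_mono[OF orthonormal_independent[OF orthonormal_B]]) auto
  have "x \<in> span ?F" if x: "x \<in> root_space br g \<alpha>" for x
  proof -
    have "g x e = 0" if "e \<in> E' \<union> Ep" "rt e \<noteq> \<alpha>" for e
      by (rule roots_ortho[OF x rt_space]) (use that rt_adual roots_adual[OF \<alpha>(1)] in auto)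
    moreover have "rt e \<noteq> \<alpha>" if "e \<in> Ep" for e using Z_weight(2)[OF that] \<alpha> by auto
    ultimately have "(g e e * g x e) *\<^sub>R e \<in> span ?F" if "e \<in> E' \<union> Ep" for e
      using that by (cases "rt e = \<alpha>") (auto intro: span_scale span_base simp: span_zero)
    then show ?thesis
      using onb_expand[OF onb_B root_space_n[OF x]] by (metis (no_types, lifting) span_sum)
  qed
  moreover have "e \<in> root_space br g \<alpha>" if "e \<in> ?F" for e
    using rt_space[of e] that by auto
  ultimately show "span ?F = span (root_space br g \<alpha>)"
    by (intro span_eq[THEN iffD2]) (auto intro: span_base)
qed

lemma pos_roots_eq: "pos_roots br g L L' = rt ` E'"
proof
  show "rt ` E' \<subseteq> pos_roots br g L L'" using rt_pos by blast
  show "pos_roots br g L L' \<subseteq> rt ` E'"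
  proof
    fix \<alpha> assume \<alpha>: "\<alpha> \<in> pos_roots br g L L'"
    then have "\<alpha> \<in> roots br g" unfolding pos_roots_def by blast
    then obtain X where X: "X \<in> root_space br g \<alpha>" "X \<noteq> 0" by (rule root_vector)
    have "\<exists>e\<in>E'. g X e \<noteq> 0"
      using onb_eqI[OF onb_E' root_space_att(1)[OF \<alpha> X(1)], of 0] X(2)
        subspace_0[OF onb_subspace[OF onb_E']] by auto
    then obtain e where e: "e \<in> E'" "g X e \<noteq> 0" by blast
    then have "rt e = \<alpha>"
      using roots_ortho[OF X(1) rt_space[of e]] roots_adual[OF \<open>\<alpha> \<in> roots br g\<close>] rt_adual[of e]
      by blast
    then show "\<alpha> \<in> rt ` E'" using e by blast
  qed
qed

text \<open>Group the sum by roots and reindex by the reflection in \<open>\<beta>\<close>.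
  Multiplicities and the values \<open>\<alpha> A\<close> stay,
  \<open>\<alpha> (sharp br g \<beta>)\<close> changes sign, so the sum equals its own
  negative.\<close>

lemma reflection_sum:
  assumes \<beta>: "\<beta> \<in> L'" and A: "A \<in> att_a br g L L'"
  shows "(\<Sum>e\<in>E'. F (rt e A) * rt e (sharp br g \<beta>)) = 0"
proof -
  let ?P = "pos_roots br g L L'" and ?s = "reflection br g \<beta>" and ?m = "\<lambda>\<alpha>. card {e\<in>E'. rt e = \<alpha>}"
  let ?S = "sharp br g \<beta>"
  have finE: "finite E'" using finite_B by simp
  have \<beta>_adual: "\<beta> \<in> adual br" using \<beta> L'_sub L_adual by blast
  have bij: "bij_betw ?s ?P ?P"
    and dim: "\<And>\<alpha>. \<alpha> \<in> ?P \<Longrightarrow> dim (root_space br g \<alpha>) = dim (root_space br g (?s \<alpha>))"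
    using attaching_data \<beta> unfolding attaching_data_def by auto
  have m: "?m (?s \<alpha>) = ?m \<alpha>" if "\<alpha> \<in> ?P" for \<alpha>
    using dim[OF that] dim_root_space[OF that] dim_root_space[of "?s \<alpha>"] bij_betwE[OF bij] that
    by simp
  have "?S \<noteq> 0"
  proof
    assume "?S = 0"
    then have "\<beta> x = 0" for x using g_sharp[OF \<beta>_adual, of x] by simp
    moreover have "\<beta> \<in> L" using \<beta> L'_sub by blast
    ultimately show False using dual_vec(2)[of \<beta> \<beta>] by simp
  qed
  then have nz: "\<beta> ?S \<noteq> 0"
    using a_pos[OF sharp_a[OF \<beta>_adual]] g_sharp[OF \<beta>_adual, of ?S] by simp
  have s_A: "?s \<alpha> A = \<alpha> A" for \<alpha>
    unfolding reflection_def using L'_att_a[OF \<beta> A] by simp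
  have s_S: "?s \<alpha> ?S = - \<alpha> ?S" if "\<alpha> \<in> ?P" for \<alpha>
  proof -
    have "\<alpha> \<in> adual br" using that roots_adual unfolding pos_roots_def by blast
    then show ?thesis
      unfolding reflection_def dual_prod_def using nz g_sharp \<beta>_adual by (simp add: field_simps)
  qed
  have "(\<Sum>e\<in>E'. F (rt e A) * rt e ?S)
      = (\<Sum>\<alpha>\<in>rt ` E'. \<Sum>e\<in>{e\<in>E'. rt e = \<alpha>}. F (rt e A) * rt e ?S)"
    by (rule sum.image_gen[OF finE])
  also have "\<dots> = (\<Sum>\<alpha>\<in>?P. real (?m \<alpha>) * (F (\<alpha> A) * \<alpha> ?S))"
    unfolding pos_roots_eq by (intro sum.cong refl) simp
  finally have sum: "(\<Sum>e\<in>E'. F (rt e A) * rt e ?S) = (\<Sum>\<alpha>\<in>?P. real (?m \<alpha>) * (F (\<alpha> A) * \<alpha> ?S))" .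
  also have "\<dots> = (\<Sum>\<alpha>\<in>?P. real (?m (?s \<alpha>)) * (F (?s \<alpha> A) * ?s \<alpha> ?S))"
    by (rule sum.reindex_bij_betw[OF bij, symmetric])
  also have "\<dots> = (\<Sum>\<alpha>\<in>?P. - (real (?m \<alpha>) * (F (\<alpha> A) * \<alpha> ?S)))"
    by (intro sum.cong refl) (simp add: m s_A s_S)
  also have "\<dots> = - (\<Sum>e\<in>E'. F (rt e A) * rt e ?S)" unfolding sum by (rule sum_negf)
  finally show ?thesis by simp
qed

text \<open>The symmetry \<open>\<beta> (sharp br g \<alpha>) = \<alpha> (sharp br g
  \<beta>)\<close> turns vanishing under \<open>\<beta>\<close> into
  \<open>reflection_sum\<close>.\<close>

lemma sum_sharp_att_a:
  assumes "A \<in> att_a br g L L'"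
  shows "(\<Sum>e\<in>E'. F (rt e A) *\<^sub>R sharp br g (rt e)) \<in> att_a br g L L'"
proof (rule in_att_aI)
  show "(\<Sum>e\<in>E'. F (rt e A) *\<^sub>R sharp br g (rt e)) \<in> aa br g"
    using subspace_a sharp_a rt_adual by (intro subspace_sum subspace_scale) auto
  fix \<beta> assume \<beta>: "\<beta> \<in> L'"
  then have \<beta>_adual: "\<beta> \<in> adual br" using L'_sub L_adual by blast
  note lin = adual_linear[OF \<beta>_adual]
  have "\<beta> (sharp br g (rt e)) = rt e (sharp br g \<beta>)" if "e \<in> E'" for e
    using g_sharp[OF \<beta>_adual, of "sharp br g (rt e)"] g_sharp[OF rt_adual, of e "sharp br g \<beta>"] that
      g_commute by auto
  then show "\<beta> (\<Sum>e\<in>E'. F (rt e A) *\<^sub>R sharp br g (rt e)) = 0"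
    using reflection_sum[OF \<beta> assms, of F] by (simp add: linear_sum[OF lin] linear_scale[OF lin])
qed

section \<open>Mean curvature vectors and Ricci curvature on \<open>\<a>'\<close>\<close>

lemma g_sum_sharp:
  assumes "F \<subseteq> E' \<union> Ep"
  shows "g (\<Sum>e\<in>F. c e *\<^sub>R sharp br g (rt e)) x = (\<Sum>e\<in>F. c e * rt e x)"
  using assms by (auto simp: g_sharp rt_adual intro!: sum.cong)

lemma mean_curvature_s: "mean_curvature UNIV br g = (\<Sum>e\<in>E' \<union> Ep. sharp br g (rt e))"
  unfolding S_h[symmetric]
proof (rule S.mean_curvature_eq, unfold span_Ba)
  show "(\<Sum>e\<in>E' \<union> Ep. sharp br g (rt e)) \<in> aa br g"
    using subspace_a sharp_a rt_adual by (intro subspace_sum) auto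
  show "g (\<Sum>e\<in>E' \<union> Ep. sharp br g (rt e)) A = tr (E' \<union> Ep) (br A)" if "A \<in> aa br g" for A
    using g_sum_sharp[of "E' \<union> Ep" "\<lambda>_. 1" A] tr_ad(1)[OF order_refl that] by simp
qed

lemma mean_curvature_s': "mean_curvature (att_s br g L L') br g = (\<Sum>e\<in>E'. sharp br g (rt e))"
  unfolding S'_h[symmetric]
proof (rule S'.mean_curvature_eq, unfold span_Ba')
  \<comment> \<open>For the constant function \<open>1\<close> any point of \<open>\<a>'\<close>
    will do; \<open>0\<close> is taken.\<close>
  show "(\<Sum>e\<in>E'. sharp br g (rt e)) \<in> att_a br g L L'"
    using sum_sharp_att_a[of 0 "\<lambda>_. 1"] unfolding att_a_def by (simp add: span_zero)
  show "g (\<Sum>e\<in>E'. sharp br g (rt e)) A = tr E' (br A)" if "A \<in> att_a br g L L'" for A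
    using g_sum_sharp[of E' "\<lambda>_. 1" A] tr_ad(1)[of E' A] att_a_sub that by auto
qed

text \<open>Null roots vanish on \<open>A\<close>, so \<open>Ep\<close> adds nothing to the trace
  over \<open>\<n>\<close>; as \<open>?V\<close> lies in \<open>\<a>'\<close>, it is the value of
  both Ricci endomorphisms.\<close>

lemma Ric_att_a:
  assumes A: "A \<in> att_a br g L L'"
  shows "Ric UNIV br g A = Ric (att_s br g L L') br g A"
proof -
  let ?V = "- (\<Sum>e\<in>E'. rt e A *\<^sub>R sharp br g (rt e))"
  have A_a: "A \<in> aa br g" using A att_a_sub by blast
  have V: "?V \<in> att_a br g L L'"
    using sum_sharp_att_a[OF A, of "\<lambda>x. x"] unfolding att_a_def by (rule span_neg)
  have g_V: "g ?V C = - (\<Sum>e\<in>E'. rt e A * rt e C)" for C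
    using g_sum_sharp[of E' "\<lambda>e. rt e A" C] by simp
  have "Ric S.h br g A = ?V"
  proof (rule S.Ric_h_a, unfold span_Ba)
    show "g ?V C = - tr (E' \<union> Ep) (\<lambda>z. br A (br C z))" if C: "C \<in> aa br g" for C
      using tr_ad(2)[OF order_refl A_a C] null_root_att_a[OF rt_null A]
      unfolding g_V sum_B by simp
  qed (use A_a V att_a_sub in auto)
  moreover have "Ric S'.h br g A = ?V"
  proof (rule S'.Ric_h_a, unfold span_Ba')
    show "g ?V C = - tr E' (\<lambda>z. br A (br C z))" if C: "C \<in> att_a br g L L'" for C
      using tr_ad(2)[of E' A C] A_a C att_a_sub unfolding g_V by auto
  qed (use A V in auto)
  ultimately show ?thesis unfolding S_h S'_h by simp
qed

text \<open>On \<open>\<n>'\<close> both Ricci endomorphisms are expanded by \<open>Ric_h_n\<close>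
  and the terms regrouped; on \<open>\<a>'\<close> they agree by \<open>Ric_att_a\<close>, and
  additivity covers the sums.\<close>

lemma Ric_eq_iff:
  "(\<forall>X\<in>att_s br g L L'. Ric UNIV br g X = Ric (att_s br g L L') br g X) \<longleftrightarrow>
   (\<forall>X\<in>att_n br g L L'. Ric (nn br) br g X - Ric (att_n br g L L') br g X
      = br (mean_curvature UNIV br g - mean_curvature (att_s br g L L') br g) X)"
proof -
  let ?H = "mean_curvature UNIV br g" and ?H' = "mean_curvature (att_s br g L L') br g"
  have sub: "X \<in> nn br" if "X \<in> att_n br g L L'" for X
    using that span_mono[of E' "E' \<union> Ep"] unfolding span_B[symmetric] span_E'[symmetric] by auto
  have n: "Ric UNIV br g X = Ric (att_s br g L L') br g X \<longleftrightarrow>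
      Ric (nn br) br g X - Ric (att_n br g L L') br g X = br (?H - ?H') X"
    if X: "X \<in> att_n br g L L'" for X
  proof -
    have "Ric UNIV br g X = Ric (nn br) br g X - br ?H X"
      using S.Ric_h_n[of X] sub[OF X] unfolding span_B S_h by simp
    moreover have "Ric (att_s br g L L') br g X = Ric (att_n br g L L') br g X - br ?H' X"
      using S'.Ric_h_n[of X] X unfolding span_E' S'_h by simp
    ultimately have "Ric UNIV br g X = Ric (att_s br g L L') br g X \<longleftrightarrow>
        Ric (nn br) br g X - br ?H X = Ric (att_n br g L L') br g X - br ?H' X" by simp
    moreover have "u - v = u' - v' \<longleftrightarrow> u - u' = v - v'" for u v u' v' :: 'a
      by (simp add: algebra_simps)
    ultimately show ?thesis by (simp only: br_diff)
  qed
  have s': "att_n br g L L' \<subseteq> att_s br g L L'"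
    unfolding S'_h[symmetric] using S'.n_sub_h unfolding span_E' by blast
  have a': "att_a br g L L' \<subseteq> att_s br g L L'"
    unfolding S'_h[symmetric] using S'.a_sub_h unfolding span_Ba' by blast
  have "Ric UNIV br g (A + X) = Ric (att_s br g L L') br g (A + X)"
    if "A \<in> att_a br g L L'" "X \<in> att_n br g L L'"
      "Ric UNIV br g X = Ric (att_s br g L L') br g X" for A X
  proof -
    have "A \<in> S'.h" "X \<in> S'.h" using that s' a' unfolding S'_h by auto
    then show ?thesis
      using S.Ric_h_add[of A X] S'.Ric_h_add[of A X] Ric_att_a[OF that(1)] that(3)
      unfolding S_h S'_h by simp
  qed
  then have "(\<forall>X\<in>att_s br g L L'. Ric UNIV br g X = Ric (att_s br g L L') br g X) \<longleftrightarrow>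
      (\<forall>X\<in>att_n br g L L'. Ric UNIV br g X = Ric (att_s br g L L') br g X)"
    using s' unfolding att_s_def[of br g L L'] by blast
  then show ?thesis using n by simp
qed

section \<open>The difference of the Ricci endomorphisms of \<open>\<n>\<close> and
  \<open>\<n>'\<close>\<close>

abbreviation "adj \<equiv> \<lambda>e. adjoint_on (nn br) g (br e)"

lemma adj: "adj e x \<in> nn br" "y \<in> nn br \<Longrightarrow> g (adj e x) y = g x (br e y)"
  using adjoint_on[OF onb_B linear_br_right] by auto

lemma att_n_sub_n: "X \<in> att_n br g L L' \<Longrightarrow> X \<in> nn br"
  using span_mono[of E' "E' \<union> Ep"] unfolding span_B[symmetric] span_E'[symmetric] by auto

lemma g_br_adj:
  assumes "Y \<in> nn br"
  shows "g (br e (adj e X)) Y = (\<Sum>f\<in>E' \<union> Ep. g f f * g X (br e f) * g Y (br e f))"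
proof -
  have "g (br e (adj e X)) Y = g (adj e Y) (adj e X)"
    using adj(2)[OF adj(1), of e Y e X] g_commute by metis
  also have "\<dots> = (\<Sum>f\<in>E' \<union> Ep. g f f * g (adj e Y) f * g f (adj e X))"
    by (rule onb_expand_g[OF onb_B adj(1), symmetric])
  also have "\<dots> = (\<Sum>f\<in>E' \<union> Ep. g f f * g X (br e f) * g Y (br e f))"
  proof (intro sum.cong refl)
    fix f assume "f \<in> E' \<union> Ep"
    then have "f \<in> nn br" by (rule onb_in[OF onb_B])
    then show "g f f * g (adj e Y) f * g f (adj e X) = g f f * g X (br e f) * g Y (br e f)"
      using adj(2) g_commute[of f "adj e X"] by simp
  qed
  finally show ?thesis .
qed

text \<open>The Ricci form of \<open>\<n>\<close> respects the grading by \<open>Z\<close>: a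
  bracket of basis vectors cannot have products with vectors of two different weights, and
  \<open>br Y e\<close> and \<open>br x e\<close> have different weights.\<close>

lemma ricci_nil_n_n0:
  assumes X: "X \<in> att_n br g L L'" and Y: "Y \<in> Ep"
  shows "ricci_nil (E' \<union> Ep) X Y = 0"
proof -
  have "ricci_nil (E' \<union> Ep) Y x = 0" if x: "x \<in> E'" for x
  proof -
    have xZ: "rt x Z > 0" "rt Y Z = 0" using Z_weight x Y by auto
    have "g (br e f) x = 0 \<or> g (br e f) Y = 0" if "e \<in> E' \<union> Ep" "f \<in> E' \<union> Ep" for e f
      using g_br_zero[OF that, of x] g_br_zero[OF that, of Y] x Y xZ by force
    then have "(\<Sum>e\<in>E' \<union> Ep. \<Sum>f\<in>E' \<union> Ep. g e e * g f f * g (br e f) Y * g (br e f) x) = 0"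
      by (intro sum.neutral ballI) auto
    moreover have "g (br Y e) (br x e) = 0" if e: "e \<in> E' \<union> Ep" for e
      by (rule root_space_ortho[OF br_root_space[OF rt_space rt_space] br_root_space[OF rt_space rt_space] Z_a])
        (use x Y e xZ in auto)
    ultimately show ?thesis unfolding ricci_nil_def by simp
  qed
  then have "ricci_nil (E' \<union> Ep) Y X = 0"
    using linear_eq_0_on_span[OF linear_ricci_nil, of E'] X unfolding span_E' by blast
  then show ?thesis using ricci_nil_commute by simp
qed

text \<open>Terms with both indices in \<open>Ep\<close> vanish, since those brackets stay in
  \<open>att_n0\<close>. Mixed terms occur twice, which turns the factor 1/4 into 1/2.\<close>

lemma ricci_nil_difference:
  assumes X: "X \<in> att_n br g L L'" and Y: "Y \<in> att_n br g L L'"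
  shows "ricci_nil (E' \<union> Ep) X Y - ricci_nil E' X Y
    = (\<Sum>e\<in>Ep. g e e * ((\<Sum>f\<in>E'. g f f * g X (br e f) * g Y (br e f)) - g (br e X) (br e Y))) / 2"
proof -
  let ?t = "\<lambda>e f. g e e * g f f * g (br e f) X * g (br e f) Y"
  let ?s = "\<lambda>e. g e e * g (br X e) (br Y e)"
  have pp: "(\<Sum>e\<in>Ep. \<Sum>f\<in>Ep. ?t e f) = 0"
    using att_n_ortho_n0[OF X br_Ep_Ep] g_commute[of X] by (intro sum.neutral ballI) simp
  have np: "(\<Sum>e\<in>E'. \<Sum>f\<in>Ep. ?t e f) = (\<Sum>e\<in>Ep. \<Sum>f\<in>E'. ?t e f)"
  proof -
    have "(\<Sum>e\<in>E'. \<Sum>f\<in>Ep. ?t e f) = (\<Sum>f\<in>Ep. \<Sum>e\<in>E'. ?t e f)" by (rule sum.swap)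
    also have "\<dots> = (\<Sum>f\<in>Ep. \<Sum>e\<in>E'. ?t f e)"
    proof (intro sum.cong refl)
      show "?t e f = ?t f e" for e f using br_antisym[of e f] by simp
    qed
    finally show ?thesis .
  qed
  have "(\<Sum>e\<in>Ep. g e e * (\<Sum>f\<in>E'. g f f * g X (br e f) * g Y (br e f)))
      = (\<Sum>e\<in>Ep. \<Sum>f\<in>E'. ?t e f)"
    unfolding sum_distrib_left
    by (intro sum.cong refl) (simp add: g_commute[of X] g_commute[of Y])
  moreover have "(\<Sum>e\<in>Ep. g e e * g (br e X) (br e Y)) = (\<Sum>e\<in>Ep. ?s e)"
  proof (intro sum.cong refl)
    show "g e e * g (br e X) (br e Y) = ?s e" for e
      using br_antisym[of e X] br_antisym[of e Y] by simp
  qed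
  ultimately show ?thesis
    unfolding ricci_nil_def sum_B
    by (simp add: sum.distrib pp np right_diff_distrib sum_subtractf diff_divide_distrib
        add_divide_distrib)
qed

text \<open>The sum of \<open>?R\<close> and \<open>?D\<close> is tested on basis vectors: on
  \<open>E'\<close> it is \<open>ricci_nil_difference\<close>, and on \<open>Ep\<close> everything
  vanishes by the grading.\<close>

lemma Ric_n_difference:
  assumes X: "X \<in> att_n br g L L'"
  shows "Ric (nn br) br g X - Ric (att_n br g L L') br g X
    = - (1/2) *\<^sub>R (\<Sum>e\<in>Ep. g e e *\<^sub>R (adj e (br e X) - br e (adj e X)))" (is "_ = ?D")
proof -
  let ?R = "Ric (att_n br g L L') br g X"
  have R: "?R \<in> att_n br g L L'" "\<And>Y. Y \<in> att_n br g L L' \<Longrightarrow> g ?R Y = ricci_nil E' X Y"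
    using S'.Ric_n[of X] X unfolding span_E' by auto
  have g_D: "g ?D Y = (\<Sum>e\<in>Ep. g e e * ((\<Sum>f\<in>E' \<union> Ep. g f f * g X (br e f) * g Y (br e f))
      - g (br e X) (br e Y))) / 2" if "Y \<in> nn br" for Y
    using adj(2)[OF that] g_br_adj[OF that]
    by (simp add: sum_divide_distrib[symmetric] sum_negf[symmetric] minus_divide_left[symmetric])
      (simp add: right_diff_distrib sum_subtractf diff_divide_distrib)
  have zero: "g X (br e f) = 0" if "e \<in> Ep" "f \<in> Ep" for e f
    using att_n_ortho_n0[OF X br_Ep_Ep[OF that]] .
  have "g (?R + ?D) y = ricci_nil (E' \<union> Ep) X y" if y: "y \<in> E' \<union> Ep" for y
  proof (cases "y \<in> E'")
    case True
    then have y': "y \<in> att_n br g L L'" by (rule onb_in[OF onb_E'])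
    have "g ?D y = ricci_nil (E' \<union> Ep) X y - ricci_nil E' X y"
      unfolding g_D[OF att_n_sub_n[OF y']] ricci_nil_difference[OF X y']
      using zero by (simp add: sum_B)
    then show ?thesis using R(2)[OF y'] by simp
  next
    case False
    then have yp: "y \<in> Ep" using y by blast
    have "g ?R y = 0" by (rule att_n_ortho_n0[OF R(1) onb_in[OF onb_Ep yp]])
    moreover have "g ?D y = 0"
    proof -
      have "g (br e X) (br e y) = 0" "(\<Sum>f\<in>E' \<union> Ep. g f f * g X (br e f) * g y (br e f)) = 0"
        if e: "e \<in> Ep" for e
      proof -
        show "g (br e X) (br e y) = 0"
          using att_n_ortho_n0[OF br_B_att_n[OF _ X] br_Ep_Ep[OF e yp]] e by blast
        have "g y (br e f) = 0" if "f \<in> E'" for f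
          using att_n_ortho_n0[OF br_B_E'[of e f] onb_in[OF onb_Ep yp]] e that g_commute[of y] by simp
        then show "(\<Sum>f\<in>E' \<union> Ep. g f f * g X (br e f) * g y (br e f)) = 0"
          using zero[OF e] by (intro sum.neutral ballI) auto
      qed
      then show ?thesis unfolding g_D[OF onb_in[OF onb_B y]] by simp
    qed
    ultimately show ?thesis using ricci_nil_n_n0[OF X yp] by simp
  qed
  then have "g (?R + ?D) Y = ricci_nil (E' \<union> Ep) X Y" if "Y \<in> nn br" for Y
    using linear_eq_on_span[OF linear_g_right linear_ricci_nil, of "E' \<union> Ep"] that
    unfolding span_B by blast
  moreover have "?D \<in> nn br"
    using subspace_n adj(1) br_in_n
    by (intro subspace_scale subspace_sum subspace_diff) auto
  then have "?R + ?D \<in> nn br"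
    using subspace_n att_n_sub_n[OF R(1)] by (simp only: subspace_add)
  ultimately have "Ric (nn br) br g X = ?R + ?D"
    using S.Ric_n_eqI[of X "?R + ?D"] att_n_sub_n[OF X] unfolding span_B by blast
  then show ?thesis by simp
qed

text \<open>The functional \<open>y \<mapsto> g e (br e y)\<close> vanishes on \<open>\<n>\<close>,
  because \<open>br e f\<close> has larger \<open>A0\<close> weight than \<open>e\<close>;
  \<open>Z\<close> could not show this inside \<open>Ep\<close>. On \<open>\<a>\<close> it is
  \<open>- rt e A * g e e\<close>.\<close>

lemma adjoint_self:
  assumes e: "e \<in> E' \<union> Ep"
  shows "adjoint_on UNIV g (br e) e = - (g e e *\<^sub>R sharp br g (rt e))"
proof -
  let ?v = "- (g e e *\<^sub>R sharp br g (rt e))"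
  have "g ?v y = g e (br e y)" for y
  proof -
    obtain A X where AX: "A \<in> aa br g" "X \<in> nn br" "y = A + X" by (rule a_n_cases)
    have "g e (br e f) = 0" if f: "f \<in> E' \<union> Ep" for f
      using root_space_ortho[OF rt_space[OF e] br_root_space[OF rt_space[OF e] rt_space[OF f]] A0(1)]
        A0(2)[OF rt_root[OF f]] by simp
    then have "g e (br e X) = 0"
      using linear_eq_0_on_span[OF linear_compose[OF linear_br_right linear_g_right, of e e], of "E' \<union> Ep" X]
        AX(2) unfolding span_B by simp
    moreover have "g e (br e A) = - (rt e A * g e e)"
      using br_antisym[of e A] rt_br[OF e AX(1)] by simp
    ultimately show ?thesis
      using AX(3) g_sharp[OF rt_adual[OF e]] adual_n[OF rt_adual[OF e] AX(2)]
        linear_add[OF adual_linear[OF rt_adual[OF e]], of A X] by simp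
  qed
  then show ?thesis
    unfolding adjoint_on_def using S_h S.onb_h by (intro onb_the_eq[of UNIV "Ba \<union> (E' \<union> Ep)"]) auto
qed

text \<open>The signs \<open>g e e\<close> square to \<open>1\<close>, and \<open>H - H'\<close> is
  the sum of the vectors \<open>sharp br g (rt e)\<close> over \<open>Ep\<close>.\<close>

lemma sum_adjoint_self:
  "(\<Sum>e\<in>Ep. g e e *\<^sub>R adjoint_on UNIV g (br e) e)
    = - (mean_curvature UNIV br g - mean_curvature (att_s br g L L') br g)"
proof -
  have "(\<Sum>e\<in>Ep. g e e *\<^sub>R adjoint_on UNIV g (br e) e) = (\<Sum>e\<in>Ep. - sharp br g (rt e))"
  proof (intro sum.cong refl)
    fix e assume "e \<in> Ep"
    then show "g e e *\<^sub>R adjoint_on UNIV g (br e) e = - sharp br g (rt e)"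
      using adjoint_self[of e] orthonormal_square[OF orthonormal_B, of e] by simp
  qed
  then show ?thesis
    unfolding mean_curvature_s mean_curvature_s' sum_B by (simp add: sum_negf)
qed

text \<open>The right side mentions no basis, so the condition holds for one compatible basis
  exactly if it holds for all.\<close>

lemma jacobi_star_iff:
  "(\<forall>X\<in>att_n br g L L'. (1/2) *\<^sub>R (\<Sum>e\<in>Ep. g e e *\<^sub>R (adj e (br e X) - br e (adj e X)))
      = br (\<Sum>e\<in>Ep. g e e *\<^sub>R adjoint_on UNIV g (br e) e) X) \<longleftrightarrow>
   (\<forall>X\<in>att_n br g L L'. Ric (nn br) br g X - Ric (att_n br g L L') br g X
      = br (mean_curvature UNIV br g - mean_curvature (att_s br g L L') br g) X)"
proof (intro ball_cong refl)
  fix X assume X: "X \<in> att_n br g L L'"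
  let ?S = "(1/2) *\<^sub>R (\<Sum>e\<in>Ep. g e e *\<^sub>R (adj e (br e X) - br e (adj e X)))"
  let ?H = "mean_curvature UNIV br g - mean_curvature (att_s br g L L') br g"
  have d: "Ric (nn br) br g X - Ric (att_n br g L L') br g X = - ?S"
    unfolding Ric_n_difference[OF X] by (simp only: scaleR_minus_left)
  have "u = - v \<longleftrightarrow> - u = v" for u v :: 'a by auto
  then show "?S = br (\<Sum>e\<in>Ep. g e e *\<^sub>R adjoint_on UNIV g (br e) e) X \<longleftrightarrow>
    Ric (nn br) br g X - Ric (att_n br g L L') br g X = br ?H X"
    unfolding sum_adjoint_self br_minus d .
qed

end

lemma (in attached) ex_compatible:
  assumes "compatible_onb br g L L' E' Ep"
  obtains Ba Ba' A0 where "compatible g br L L' E' Ep Ba Ba' A0"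
proof -
  obtain Ba where Ba: "onb (aa br g) Ba" using ex_onb_a[OF subspace_a order_refl] by blast
  obtain Ba' where Ba': "onb (att_a br g L L') Ba'"
    using ex_onb_a[OF _ att_a_sub] unfolding att_a_def by auto
  obtain A0 where A0: "A0 \<in> aa br g" "\<And>\<alpha>. \<alpha> \<in> roots br g \<Longrightarrow> \<alpha> A0 > 0"
    using ex_positive by auto
  have "compatible g br L L' E' Ep Ba Ba' A0"
    using assms Ba Ba' A0 by unfold_locales
  then show ?thesis by (rule that)
qed

theorem mainTheorem1:
  fixes br :: "'v::real_vector \<Rightarrow> 'v \<Rightarrow> 'v"
    and g :: "'v \<Rightarrow> 'v \<Rightarrow> real"
    and \<Lambda> \<Lambda>' :: "('v \<Rightarrow> real) set"
  assumes "strong_iwasawa br g"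
    and "root_decomposition br g"
    and "attaching_data br g \<Lambda> \<Lambda>'"
  defines "\<n> \<equiv> nn br"
    and "\<s>' \<equiv> att_s br g \<Lambda> \<Lambda>'"
    and "\<n>' \<equiv> att_n br g \<Lambda> \<Lambda>'"
  defines "H \<equiv> mean_curvature UNIV br g"
    and "H' \<equiv> mean_curvature \<s>' br g"
  shows "((\<forall>X\<in>\<s>'. Ric UNIV br g X = Ric \<s>' br g X) \<longleftrightarrow>
          (\<forall>X\<in>\<n>'. Ric \<n> br g X - Ric \<n>' br g X = br (H - H') X)) \<and>
         ((\<forall>X\<in>\<n>'. Ric \<n> br g X - Ric \<n>' br g X = br (H - H') X) \<longleftrightarrow>
          jacobi_star br g \<Lambda> \<Lambda>')"
proof -
  interpret attached g br \<Lambda> \<Lambda>'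
    using assms(1-3) by unfold_locales
  let ?ii = "\<forall>X\<in>att_n br g \<Lambda> \<Lambda>'. Ric (nn br) br g X - Ric (att_n br g \<Lambda> \<Lambda>') br g X
      = br (mean_curvature UNIV br g - mean_curvature (att_s br g \<Lambda> \<Lambda>') br g) X"
  let ?star = "\<lambda>Ep. \<forall>X\<in>att_n br g \<Lambda> \<Lambda>'.
      (1/2) *\<^sub>R (\<Sum>e\<in>Ep. g e e *\<^sub>R (adjoint_on (nn br) g (br e) (br e X)
        - br e (adjoint_on (nn br) g (br e) X)))
      = br (\<Sum>e\<in>Ep. g e e *\<^sub>R adjoint_on UNIV g (br e) e) X"
  \<comment> \<open>Proved for every compatible basis: from (ii) it is applied to the constructed
    one, from (iii) to the one that the condition provides.\<close>
  have star: "?star Ep \<longleftrightarrow> ?ii" if E: "compatible_onb br g \<Lambda> \<Lambda>' E' Ep" for E' Ep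
  proof -
    obtain Ba Ba' A0 where "compatible g br \<Lambda> \<Lambda>' E' Ep Ba Ba' A0"
      by (rule ex_compatible[OF E])
    then show ?thesis by (rule compatible.jacobi_star_iff)
  qed
  obtain E' Ep where E: "compatible_onb br g \<Lambda> \<Lambda>' E' Ep" using ex_compatible_onb by auto
  obtain Ba Ba' A0 where c: "compatible g br \<Lambda> \<Lambda>' E' Ep Ba Ba' A0"
    by (rule ex_compatible[OF E])
  have "?ii \<longleftrightarrow> jacobi_star br g \<Lambda> \<Lambda>'"
  proof
    assume ?ii
    then have "?star Ep" by (rule star[OF E, THEN iffD2])
    with E show "jacobi_star br g \<Lambda> \<Lambda>'" unfolding jacobi_star_def by (intro exI conjI)
  next
    assume "jacobi_star br g \<Lambda> \<Lambda>'"
    then obtain E1 E2 where "compatible_onb br g \<Lambda> \<Lambda>' E1 E2" "?star E2"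
      unfolding jacobi_star_def by (elim exE conjE)
    then show ?ii by (rule star[THEN iffD1])
  qed
  with compatible.Ric_eq_iff[OF c] show ?thesis
    unfolding assms(4-8) by (rule conjI)
qed

end
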